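(* Let $\mathcal X\subset\mathbb R^m$ be compact, $A\in\mathbb R^{d\times m}$, $b\in\mathbb R^d$, $\alpha>0$, $\beta>0$, and let $g:\mathbb R^d\to\mathbb R$ be convex and differentiable with globally $\frac1\beta$-Lipschitz gradient. Let $\mu\in\mathcal P(\mathcal X)$, let $X_1,\dots,X_n$ be i.i.d. with law $\mu$, and let $\hat\mu_n=\frac1n\sum_{i=1}^n\delta_{X_i}$. Let $\varepsilon\ge 0$ and let $z_{\hat\mu_n,\varepsilon}$ be an $\varepsilon$-approximate solution of the dual MEM problem for $\hat\mu_n$, i.e. $$\phi_{\hat\mu_n}(z_{\hat\mu_n,\varepsilon})\le \inf_{z\in\mathbb R^d}\phi_{\hat\mu_n}(z)+\varepsilon,$$ obtained by a measurable selection (as a function of the samples) from the set of all $\varepsilon$-approximate solutions. Let $z_\mu$ be the solution of the dual MEM problem for $\mu$. Then $$\mathbb E\big[\|z_{\hat\mu_n,\varepsilon}-z_\mu\|\big]\le \frac{C}{\sqrt n}+\sqrt{\frac{2\alpha}{\beta}\varepsilon},$$ where $C=\frac{\alpha}{\beta}\|A\|C'$ and $C'=2|\mathrm{supp}(\mu)|_\infty\exp\big(2\|A\|\,\|z_\mu\|\,|\mathrm{supp}(\mu)|_\infty\big)$. Moreover, set $K'=|\mathrm{supp}(\mu)|_\infty^2\|A\|$, let $x_{\hat\mu_n,\varepsilon}:=\nabla L_{\hat\mu_n}(A^\top z_{\hat\mu_n,\varepsilon})$, and let $x_\mu$ be the solution of the primal MEM problem for $\mu$. Then $$\mathbb E\big[\|x_{\hat\mu_n,\varepsilon}-x_\mu\|\big]\le\frac{K'C+C'}{\sqrt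 n}+K'\sqrt{\frac{2\alpha}{\beta}\varepsilon}.$$ If, moreover, $A$ is injective and $g$ is $\frac1\gamma$-strongly convex for some $\gamma>0$, then $$\mathbb E\big[\|x_{\hat\mu_n,\varepsilon}-x_\mu\|\big]\le\frac{\gamma C}{\alpha\,\sigma_{\min}(A)}\frac1{\sqrt n}+K'\sqrt{\frac{2\alpha}{\beta}\varepsilon}.$$
   Context: $\mathcal P(\mathcal X)$ is the set of Borel probability measures on $\mathcal X$. $\|\cdot\|$ is the Euclidean norm on vectors and the operator $2$-norm on matrices; $\sigma_{\min}(A)=\sqrt{\lambda_{\min}(A^\top A)}$; for a set $S$, $|S|_\infty:=\sup_{s\in S}\|s\|$. $g^*$ is the Fenchel conjugate of $g$ (possibly extended-real-valued). For $\mu\in\mathcal P(\mathcal X)$, $L_\mu(y):=\log\int_{\mathcal X}\exp\langle y,u\rangle\,d\mu(u)$, which is finite and smooth on $\mathbb R^m$. The dual MEM problem for $\mu$ is to minimize over $z\in\mathbb R^d$ $$\phi_\mu(z):=\alpha g^*(-z/\alpha)-\langle b,z\rangle+L_\mu(A^\top z);$$ under the assumption on $g$, $\phi_\mu$ is $\frac\beta\alpha$-strongly convex and has a unique minimizer $z_\mu$. The MEM function is $\kappa_\mu(x):=\inf\{\mathrm{KL}(Q\Vert\mu): Q\in\mathcal P(\mathcal X),\ \mathbb E_Q[X]=x\}$, where $\mathrm{KL}(Q\Vert\mu)=\int\log\frac{dQ}{d\mu}\,dQ$ if $Q\ll\mu$ and $+\infty$ otherwise. The primal MEM problem for $\mu$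 is to minimize $\alpha g(Ax-b)+\kappa_\mu(x)$ over $x\in\mathbb R^m$; it has a unique solution $x_\mu$, and $x_\mu=\nabla L_\mu(A^\top z_\mu)$. *)

theory Defs
  imports "HOL-Analysis.Analysis" "HOL-Probability.Probability"
begin

definition grad :: "('a::real_inner \<Rightarrow> real) \<Rightarrow> 'a \<Rightarrow> 'a" where
  "grad f x = (THE D. GDERIV f x :> D)"

definition strongly_convex :: "real \<Rightarrow> ('a::real_inner \<Rightarrow> real) \<Rightarrow> bool" where
  "strongly_convex c f \<longleftrightarrow> convex_on UNIV (\<lambda>x. f x - c / 2 * (norm x)\<^sup>2)"

definition fenchel_conj :: "('a::real_inner \<Rightarrow> real) \<Rightarrow> 'a \<Rightarrow> ereal" where
  "fenchel_conj f y = (SUP x. ereal (y \<bullet> x - f x))"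

text \<open>The \<open>norm\<close> of a value of type \<open>real^'m^'d\<close> is the Frobenius norm, so the operator
  norm of \<open>A\<close> is written with \<open>onorm\<close>.\<close>

abbreviation op_norm :: "real^'m^'d \<Rightarrow> real" where
  "op_norm A \<equiv> onorm (\<lambda>v. A *v v)"

definition lambda_min :: "real^'n^'n \<Rightarrow> real" where
  "lambda_min B = Min {l. \<exists>v. v \<noteq> 0 \<and> B *v v = l *\<^sub>R v}"

definition sigma_min :: "real^'m^'d \<Rightarrow> real" where
  "sigma_min A = sqrt (lambda_min (transpose A ** A))"

definition sup_norm :: "'a::real_normed_vector set \<Rightarrow> real" where
  "sup_norm S = (SUP s\<in>S. norm s)"

text \<open>A Borel probability measure on \<open>\<X>\<close> has underlying space \<open>\<X>\<close> and the trace of the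
  Borel sigma-algebra; it is not a measure on the ambient space.\<close>

abbreviation borel_on :: "'a::topological_space set \<Rightarrow> 'a measure" where
  "borel_on \<X> \<equiv> restrict_space borel \<X>"

definition prob_measures :: "'a::topological_space set \<Rightarrow> 'a measure set" where
  "prob_measures \<X> = {Q. prob_space Q \<and> sets Q = sets (borel_on \<X>)}"

definition msupp :: "'a::topological_space measure \<Rightarrow> 'a set" where
  "msupp M = {x \<in> space M. \<forall>U. open U \<and> x \<in> U \<longrightarrow> emeasure M (U \<inter> space M) > 0}"

text \<open>The empirical measure is the image of the uniform distribution on the indices; the lemma
  below shows that it is the average of the point masses at the sample points.\<close>

definition empirical :: "'a measure \<Rightarrow> nat \<Rightarrow> (nat \<Rightarrow> 'a) \<Rightarrow> 'a measure" where
  "empirical N n s = distr (uniform_count_measure {..<n}) N s"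

lemma emeasure_empirical:
  assumes "s \<in> {..<n} \<rightarrow> space N" and "B \<in> sets N"
  shows "emeasure (empirical N n s) B = (\<Sum>i<n. emeasure (return N (s i)) B) / of_nat n"
proof -
  have meas: "s \<in> measurable (uniform_count_measure {..<n}) N"
    using assms(1) by (auto simp: measurable_def space_uniform_count_measure sets_uniform_count_measure)
  have "(\<Sum>i<n. emeasure (return N (s i)) B) = (\<Sum>i\<in>{i\<in>{..<n}. s i \<in> B}. (1::ennreal))"
    using assms(2) by (simp add: indicator_def sum.If_cases Int_def)
  also have "\<dots> = ennreal (real (card {i\<in>{..<n}. s i \<in> B}))"
    by (simp add: ennreal_of_nat_eq_real_of_nat)
  finally have sum: "(\<Sum>i<n. emeasure (return N (s i)) B) = \<dots>" .
  have "emeasure (empirical N n s) B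
      = emeasure (uniform_count_measure {..<n}) {i\<in>{..<n}. s i \<in> B}"
    unfolding empirical_def using meas assms(2)
    by (subst emeasure_distr)
       (auto simp: space_uniform_count_measure vimage_def Int_def conj_commute)
  also have "\<dots> = ennreal (real (card {i\<in>{..<n}. s i \<in> B}) / real n)"
    by (subst emeasure_uniform_count_measure) auto
  also have "\<dots> = (\<Sum>i<n. emeasure (return N (s i)) B) / of_nat n"
  proof (cases "n = 0")
    case False
    then show ?thesis
      unfolding sum by (simp add: divide_ennreal ennreal_of_nat_eq_real_of_nat)
  qed simp
  finally show ?thesis .
qed

text \<open>The negative part of \<open>ln (dQ/d\<mu>)\<close> is always \<open>Q\<close>-integrable, so if \<open>ln (dQ/d\<mu>)\<close> is not
  \<open>Q\<close>-integrable its integral is \<open>\<infinity>\<close>.\<close>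

definition KL :: "'a measure \<Rightarrow> 'a measure \<Rightarrow> ereal" where
  "KL Q \<mu> = (if absolutely_continuous \<mu> Q \<and> integrable Q (entropy_density (exp 1) \<mu> Q)
             then ereal (KL_divergence (exp 1) \<mu> Q) else \<infinity>)"

definition log_mgf :: "(real^'m) measure \<Rightarrow> real^'m \<Rightarrow> real" where
  "log_mgf \<mu> y = ln (\<integral>u. exp (y \<bullet> u) \<partial>\<mu>)"

definition dual_obj ::
  "(real^'d \<Rightarrow> real) \<Rightarrow> real^'m^'d \<Rightarrow> real^'d \<Rightarrow> real \<Rightarrow> (real^'m) measure \<Rightarrow> real^'d \<Rightarrow> ereal" where
  "dual_obj g A b \<alpha> \<mu> z =
     ereal \<alpha> * fenchel_conj g (- (z /\<^sub>R \<alpha>)) - ereal (b \<bullet> z) + ereal (log_mgf \<mu> (transpose A *v z))"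

definition dual_solution ::
  "(real^'d \<Rightarrow> real) \<Rightarrow> real^'m^'d \<Rightarrow> real^'d \<Rightarrow> real \<Rightarrow> (real^'m) measure \<Rightarrow> real^'d \<Rightarrow> bool" where
  "dual_solution g A b \<alpha> \<mu> z \<longleftrightarrow> is_arg_min (dual_obj g A b \<alpha> \<mu>) (\<lambda>_. True) z"

definition approx_dual_solutions ::
  "(real^'d \<Rightarrow> real) \<Rightarrow> real^'m^'d \<Rightarrow> real^'d \<Rightarrow> real \<Rightarrow> (real^'m) measure \<Rightarrow> real \<Rightarrow> (real^'d) set" where
  "approx_dual_solutions g A b \<alpha> \<mu> \<epsilon> =
     {z. dual_obj g A b \<alpha> \<mu> z \<le> (INF w. dual_obj g A b \<alpha> \<mu> w) + ereal \<epsilon>}"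

definition mem_fun :: "(real^'m) set \<Rightarrow> (real^'m) measure \<Rightarrow> real^'m \<Rightarrow> ereal" where
  "mem_fun \<X> \<mu> x = (INF Q\<in>{Q \<in> prob_measures \<X>. (\<integral>u. u \<partial>Q) = x}. KL Q \<mu>)"

definition primal_obj ::
  "(real^'m) set \<Rightarrow> (real^'d \<Rightarrow> real) \<Rightarrow> real^'m^'d \<Rightarrow> real^'d \<Rightarrow> real \<Rightarrow> (real^'m) measure
    \<Rightarrow> real^'m \<Rightarrow> ereal" where
  "primal_obj \<X> g A b \<alpha> \<mu> x = ereal (\<alpha> * g (A *v x - b)) + mem_fun \<X> \<mu> x"

definition primal_solution ::
  "(real^'m) set \<Rightarrow> (real^'d \<Rightarrow> real) \<Rightarrow> real^'m^'d \<Rightarrow> real^'d \<Rightarrow> real \<Rightarrow> (real^'m) measure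
    \<Rightarrow> real^'m \<Rightarrow> bool" where
  "primal_solution \<X> g A b \<alpha> \<mu> x \<longleftrightarrow> is_arg_min (primal_obj \<X> g A b \<alpha> \<mu>) (\<lambda>_. True) x"

end

theory Submission
  imports Defs
begin

text \<open>
  Write \<open>L\<close> for the log-moment generating function of a measure \<open>M\<close> and \<open>p y\<close> for the mean of \<open>M\<close>
  tilted by \<open>y\<close>, that is, reweighted by \<open>exp (y \<bullet> u - L y)\<close>. For a measure carried by the ball of
  radius \<open>r\<close>, Jensen's inequality and Hoeffding's lemma, applied to the tilted measures, give
  \<open>L y + p y \<bullet> h \<le> L (y + h) \<le> L y + p y \<bullet> h + r\<^sup>2 / 2 * (norm h)\<^sup>2\<close>. Hence \<open>L\<close> is convex with gradient
  \<open>p\<close>, and \<open>p\<close> is \<open>r\<^sup>2\<close>-Lipschitz (\<open>log_mgf_tangent\<close>, \<open>log_mgf_quadratic_upper\<close>,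
  \<open>tilted_mean_lipschitz\<close>).

  The dual objective is the sum of \<open>L \<circ> transpose A\<close> and a term that is strongly convex with modulus
  \<open>\<beta> / \<alpha>\<close>, because the conjugate of a smooth function is strongly convex. So a dual minimizer exists,
  an \<open>\<epsilon>\<close>-approximate solution has distance at most \<open>sqrt (2 * \<alpha> / \<beta> * \<epsilon>)\<close> from it
  (\<open>approx_minimizer_close\<close>), and the minimizers for the empirical measure and for \<open>\<mu>\<close> differ by at
  most \<open>\<alpha> / \<beta> * op_norm A\<close> times the distance \<open>\<delta>\<close> of the two tilted means at the single
  deterministic point \<open>transpose A *v z\<mu>\<close> (\<open>dual_minimizers_close\<close>).

  The randomness enters only through \<open>\<delta>\<close>. The numerator of the deviation is a normalized sum of
  independent, centered, bounded vectors, so \<open>\<delta>\<close> has expectation of order \<open>1 / sqrt n\<close>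
  (\<open>expectation_tilted_mean_deviation_le\<close>). This proves the dual bound.

  For the primal bounds, the variational lower bound on the relative entropy shows that the only
  possible primal solution is the tilted mean at \<open>transpose A *v z\<mu>\<close>
  (\<open>primal_solution_eq_tilted_mean\<close>), and Lipschitz continuity of \<open>p\<close> carries the dual bound over.
  If \<open>g\<close> is strongly convex and \<open>A\<close> is injective, the optimality condition
  \<open>- z / \<alpha> = grad g (A *v x - b)\<close>, which holds for both measures, bounds the distance of the exact
  primal solutions by the distance of the exact dual ones, which gives the last bound.
\<close>

section \<open>Gradients of convex and of smooth functions\<close>

lemma GDERIV_unique:
  assumes "GDERIV f x :> D" "GDERIV f x :> E"
  shows "D = E"
proof -
  have "(\<lambda>h. h \<bullet> D) = (\<lambda>h. h \<bullet> E)"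
    using assms unfolding gderiv_def by (rule has_derivative_unique)
  then show ?thesis
    by (metis inner_commute vector_eq_ldot)
qed

lemma grad_eqI: "GDERIV f x :> D \<Longrightarrow> grad f x = D"
  unfolding grad_def by (blast intro: GDERIV_unique)

lemma GDERIV_grad:
  fixes f :: "'a::euclidean_space \<Rightarrow> real"
  assumes "f differentiable (at x)"
  shows "GDERIV f x :> grad f x"
proof -
  obtain f' where f': "(f has_derivative f') (at x)"
    using assms unfolding differentiable_def by blast
  interpret f': bounded_linear f' using f' by (rule has_derivative_bounded_linear)
  have "f' = (\<lambda>h. h \<bullet> adjoint f' 1)"
    using adjoint_works[OF f'.linear_axioms, of _ 1] by auto
  with f' have "GDERIV f x :> adjoint f' 1"
    unfolding gderiv_def by metis
  then show ?thesis using grad_eqI by metis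
qed

lemma GDERIV_along_line:
  assumes "GDERIV f (x + t *\<^sub>R d) :> D"
  shows "((\<lambda>t. f (x + t *\<^sub>R d)) has_real_derivative d \<bullet> D) (at t)"
proof -
  have "((\<lambda>t. x + t *\<^sub>R d) has_derivative (\<lambda>s. s *\<^sub>R d)) (at t)"
    by (auto intro!: derivative_eq_intros)
  then have "((\<lambda>t. f (x + t *\<^sub>R d)) has_derivative (\<lambda>s. (s *\<^sub>R d) \<bullet> D)) (at t)"
    using assms unfolding gderiv_def by (rule has_derivative_compose)
  then show ?thesis
    by (simp add: has_field_derivative_def mult.commute[of _ "d \<bullet> D"])
qed

text \<open>The difference quotients along a segment of a convex function are bounded by the increment over
  the whole segment; the directional derivative is their limit.\<close>

lemma convex_on_tangent_le:
  assumes "convex_on UNIV f" "GDERIV f x :> D"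
  shows "f x + D \<bullet> d \<le> f (x + d)"
proof -
  have "((\<lambda>t. f (x + t *\<^sub>R d)) has_real_derivative d \<bullet> D) (at 0)"
    using assms(2) by (intro GDERIV_along_line) simp
  then have "((\<lambda>t. (f (x + t *\<^sub>R d) - f x) / t) \<longlongrightarrow> d \<bullet> D) (at_right 0)"
    unfolding DERIV_def by (auto intro: filterlim_at_split[THEN iffD1, THEN conjunct2])
  moreover have "eventually (\<lambda>t. (f (x + t *\<^sub>R d) - f x) / t \<le> f (x + d) - f x) (at_right 0)"
    unfolding eventually_at_right_field
  proof (intro exI[of _ 1] conjI allI impI)
    fix t :: real assume t: "0 < t" "t < 1"
    have "f ((1 - t) *\<^sub>R x + t *\<^sub>R (x + d)) \<le> (1 - t) * f x + t * f (x + d)"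
      using convex_onD[OF assms(1), of t x "x + d"] t by simp
    moreover have "(1 - t) *\<^sub>R x + t *\<^sub>R (x + d) = x + t *\<^sub>R d"
      by (simp add: algebra_simps)
    ultimately show "(f (x + t *\<^sub>R d) - f x) / t \<le> f (x + d) - f x"
      using t by (simp add: field_simps)
  qed simp
  ultimately have "d \<bullet> D \<le> f (x + d) - f x"
    by (intro tendsto_upperbound[where F = "at_right 0"]) auto
  then show ?thesis by (simp add: inner_commute)
qed

text \<open>At a point of differentiability the gradient is the only subgradient.\<close>

lemma subgradient_eq_GDERIV:
  assumes "GDERIV f x :> D" "\<And>d. f x + v \<bullet> d \<le> f (x + d)"
  shows "v = D"
proof -
  have "w \<bullet> D - w \<bullet> v = 0" for w
  proof -
    define \<psi> where "\<psi> t = f (x + t *\<^sub>R w) - t * (w \<bullet> v)" for t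
    have "(\<psi> has_real_derivative w \<bullet> D - w \<bullet> v) (at 0)"
      unfolding \<psi>_def using assms(1) by (auto intro!: derivative_eq_intros GDERIV_along_line)
    moreover have "\<psi> 0 \<le> \<psi> t" for t
      using assms(2)[of "t *\<^sub>R w"] by (simp add: \<psi>_def algebra_simps inner_commute)
    ultimately show ?thesis
      by (intro DERIV_local_min[of \<psi> _ 0 1]) auto
  qed
  from this[of "D - v"] have "(D - v) \<bullet> (D - v) = 0"
    by (simp add: inner_diff_right)
  then show ?thesis by simp
qed

text \<open>Along a line, \<open>f\<close> minus its claimed quadratic upper bound is nonincreasing, because the Lipschitz
  condition makes its derivative nonpositive.\<close>

lemma descent_lemma:
  fixes f :: "'a::real_inner \<Rightarrow> real"
  assumes "\<And>x. GDERIV f x :> f' x" "\<And>x y. norm (f' x - f' y) \<le> K * norm (x - y)"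
  shows "f (x + d) \<le> f x + f' x \<bullet> d + K / 2 * (norm d)\<^sup>2"
proof -
  define \<psi> where "\<psi> t = f (x + t *\<^sub>R d) - t * (d \<bullet> f' x) - K / 2 * (norm d)\<^sup>2 * t\<^sup>2" for t
  have "\<psi> 1 \<le> \<psi> 0"
  proof (rule DERIV_nonpos_imp_nonincreasing[of 0 1 \<psi>])
    fix t :: real assume t: "0 \<le> t" "t \<le> 1"
    have "(\<psi> has_real_derivative d \<bullet> f' (x + t *\<^sub>R d) - d \<bullet> f' x - K * (norm d)\<^sup>2 * t) (at t)"
      unfolding \<psi>_def by (auto intro!: derivative_eq_intros GDERIV_along_line assms(1))
    moreover have "d \<bullet> f' (x + t *\<^sub>R d) - d \<bullet> f' x \<le> norm d * norm (f' (x + t *\<^sub>R d) - f' x)"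
      using norm_cauchy_schwarz[of d "f' (x + t *\<^sub>R d) - f' x"] by (simp add: inner_diff_right)
    moreover have "norm d * norm (f' (x + t *\<^sub>R d) - f' x) \<le> norm d * (K * norm (t *\<^sub>R d))"
      using assms(2)[of "x + t *\<^sub>R d" x] by (intro mult_left_mono) auto
    ultimately show "\<exists>y. DERIV \<psi> t :> y \<and> y \<le> 0"
      using t by (intro exI conjI) (auto simp: power2_eq_square algebra_simps)
  qed simp
  then show ?thesis by (simp add: \<psi>_def inner_commute)
qed

text \<open>The argument behind the Baillon-Haddad theorem: comparing the upper bound for the step
  \<open>(1 / K) *\<^sub>R (p x - p y)\<close> from \<open>y\<close> with the tangent at \<open>x\<close> improves the tangent inequality by a
  multiple of \<open>(norm (p x - p y))\<^sup>2\<close>, and adding the improved inequalities for both orders of \<open>x\<close> and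
  \<open>y\<close> shows that \<open>p\<close> is cocoercive.\<close>

lemma quadratic_bounds_imp_gradient_lipschitz:
  fixes L :: "'a::real_inner \<Rightarrow> real" and p :: "'a \<Rightarrow> 'a"
  assumes lower: "\<And>y h. L y + p y \<bullet> h \<le> L (y + h)"
    and upper: "\<And>y h. L (y + h) \<le> L y + p y \<bullet> h + K / 2 * (norm h)\<^sup>2" and "K > 0"
  shows "norm (p x - p y) \<le> K * norm (x - y)"
proof -
  have *: "L x + p x \<bullet> (y - x) + (norm (p y - p x))\<^sup>2 / (2 * K) \<le> L y" for x y
  proof -
    define \<delta> where "\<delta> = p y - p x"
    define h where "h = - ((1 / K) *\<^sub>R \<delta>)"
    have "L x + p x \<bullet> (y - x + h) \<le> L (y + h)"
      using lower[of x "y - x + h"] by (simp add: algebra_simps)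
    also have "\<dots> \<le> L y + p y \<bullet> h + K / 2 * (norm h)\<^sup>2" by (rule upper)
    finally have "L x + p x \<bullet> (y - x) \<le> L y + \<delta> \<bullet> h + K / 2 * (norm h)\<^sup>2"
      by (simp add: \<delta>_def inner_add_right inner_diff_left)
    also have "\<delta> \<bullet> h = - (norm \<delta>)\<^sup>2 / K"
      by (simp add: h_def power2_norm_eq_inner)
    also have "(norm h)\<^sup>2 = (norm \<delta>)\<^sup>2 / K\<^sup>2"
      by (simp add: h_def power_divide)
    finally show ?thesis
      using \<open>K > 0\<close> unfolding \<delta>_def[symmetric] by (simp add: field_simps power2_eq_square)
  qed
  define \<delta> where "\<delta> = p x - p y"
  have "(norm \<delta>)\<^sup>2 / K \<le> \<delta> \<bullet> (x - y)"
    using *[of x y] *[of y x]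
    by (simp add: \<delta>_def norm_minus_commute inner_diff_left inner_diff_right field_simps)
  also have "\<dots> \<le> norm \<delta> * norm (x - y)" by (rule norm_cauchy_schwarz)
  finally have "norm \<delta> * norm \<delta> \<le> norm \<delta> * (K * norm (x - y))"
    using \<open>K > 0\<close> by (simp add: field_simps power2_eq_square)
  then show ?thesis
    using \<open>K > 0\<close> by (cases "\<delta> = 0") (auto simp: \<delta>_def)
qed

lemma quadratic_bounds_imp_GDERIV:
  fixes L :: "'a::real_inner \<Rightarrow> real"
  assumes lower: "\<And>h. L y + p \<bullet> h \<le> L (y + h)"
    and upper: "\<And>h. L (y + h) \<le> L y + p \<bullet> h + K * (norm h)\<^sup>2"
  shows "GDERIV L y :> p"
  unfolding gderiv_def has_derivative_at
proof (intro conjI bounded_linear_inner_left)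
  show "(\<lambda>h. norm (L (y + h) - L y - h \<bullet> p) / norm h) \<midarrow>0\<rightarrow> 0"
  proof (rule tendsto_sandwich[of "\<lambda>_. 0" _ _ "\<lambda>h. K * norm h"])
    show "\<forall>\<^sub>F h in at 0. norm (L (y + h) - L y - h \<bullet> p) / norm h \<le> K * norm h"
    proof (rule eventually_at_topological[THEN iffD2], intro exI[of _ UNIV] conjI ballI impI)
      fix h :: 'a assume "h \<noteq> 0"
      then show "norm (L (y + h) - L y - h \<bullet> p) / norm h \<le> K * norm h"
        using lower[of h] upper[of h]
        by (simp add: divide_simps inner_commute power2_eq_square)
    qed auto
  qed (auto intro!: tendsto_eq_intros always_eventually)
qed

text \<open>Adding the tangent inequalities of \<open>f - c / 2 * (norm _)\<^sup>2\<close> at the two points shows that the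
  gradient is strongly monotone.\<close>

lemma strongly_convex_imp_gradient_expansive:
  assumes "strongly_convex c f" "GDERIV f x :> D" "GDERIV f y :> E"
  shows "c * norm (x - y) \<le> norm (D - E)"
proof -
  have tangent: "f x + D \<bullet> (y - x) + c / 2 * (norm (y - x))\<^sup>2 \<le> f y"
    if "GDERIV f x :> D" for x y D
  proof -
    have "((\<lambda>x. x \<bullet> x) has_derivative (\<lambda>h. 2 * (h \<bullet> x))) (at x)"
      by (auto intro!: derivative_eq_intros simp: inner_commute)
    then have "((\<lambda>x. c / 2 * (x \<bullet> x)) has_derivative (\<lambda>h. c / 2 * (2 * (h \<bullet> x)))) (at x)"
      by (rule has_derivative_mult_right)
    then have "GDERIV (\<lambda>x. c / 2 * (norm x)\<^sup>2) x :> c *\<^sub>R x"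
      by (simp add: gderiv_def power2_norm_eq_inner)
    then have "GDERIV (\<lambda>x. f x - c / 2 * (norm x)\<^sup>2) x :> D - c *\<^sub>R x"
      by (intro GDERIV_diff that)
    from convex_on_tangent_le[OF assms(1)[unfolded strongly_convex_def] this, of "y - x"]
    show ?thesis
      unfolding power2_norm_eq_inner
      by (simp add: inner_diff_left inner_diff_right inner_commute algebra_simps)
  qed
  have "c * (norm (x - y))\<^sup>2 \<le> (D - E) \<bullet> (x - y)"
    using tangent[OF assms(2), of y] tangent[OF assms(3), of x]
    by (simp add: norm_minus_commute inner_diff_left inner_diff_right)
  also have "\<dots> \<le> norm (D - E) * norm (x - y)" by (rule norm_cauchy_schwarz)
  finally show ?thesis
    by (cases "x = y") (auto simp: power2_eq_square)
qed

section \<open>The smallest singular value and the operator norm\<close>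

text \<open>The adjoint rule below moves \<open>transpose A\<close> across an inner product; rewriting
  \<open>transpose A *v z\<close> to \<open>z v* A\<close> would hide its pattern.\<close>

declare transpose_matrix_vector [simp del]

lemma norm_matrix_vector_le: "norm (A *v x) \<le> op_norm A * norm x"
  for A :: "real^'m^'d"
  by (rule onorm) simp

lemma op_norm_nonneg: "0 \<le> op_norm (A :: real^'m^'d)"
  by (rule onorm_pos_le) simp

lemma inner_transpose: "x \<bullet> (transpose A *v z) = (A *v x) \<bullet> z"
  for A :: "real^'m^'d"
  by (metis dot_lmul_matrix inner_commute vector_transpose_matrix transpose_transpose)

lemma norm_transpose_vector_le: "norm (transpose A *v z) \<le> op_norm A * norm z"
  for A :: "real^'m^'d"
proof -
  let ?v = "transpose A *v z"
  have "norm ?v * norm ?v = (A *v ?v) \<bullet> z"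
    by (simp add: inner_transpose[symmetric] flip: power2_norm_eq_inner power2_eq_square)
  also have "\<dots> \<le> norm (A *v ?v) * norm z" by (rule norm_cauchy_schwarz)
  also have "\<dots> \<le> (op_norm A * norm ?v) * norm z"
    by (intro mult_right_mono norm_matrix_vector_le) simp
  finally show ?thesis
    by (cases "?v = 0") (auto simp: op_norm_nonneg algebra_simps)
qed

definition eigenvalues :: "real^'n^'n \<Rightarrow> real set" where
  "eigenvalues B = {l. \<exists>v. v \<noteq> 0 \<and> B *v v = l *\<^sub>R v}"

text \<open>Eigenvectors of a symmetric matrix for different eigenvalues are orthogonal, and a
  Euclidean space contains only finitely many pairwise orthogonal nonzero vectors.\<close>

lemma finite_eigenvalues_symmetric:
  fixes B :: "real^'n^'n"
  assumes "transpose B = B"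
  shows "finite (eigenvalues B)"
proof -
  obtain v where v: "\<And>l. l \<in> eigenvalues B \<Longrightarrow> v l \<noteq> 0 \<and> B *v v l = l *\<^sub>R v l"
    using someI_ex[of "\<lambda>v. v \<noteq> 0 \<and> B *v v = _ *\<^sub>R v"]
    by (auto simp: eigenvalues_def intro!: that[of "\<lambda>l. SOME v. v \<noteq> 0 \<and> B *v v = l *\<^sub>R v"])
  have orth: "v k \<bullet> v l = 0" if "k \<in> eigenvalues B" "l \<in> eigenvalues B" "k \<noteq> l" for k l
  proof -
    have "v k \<bullet> (B *v v l) = (B *v v k) \<bullet> v l"
      using inner_transpose[of "v k" B "v l"] assms by simp
    then have "l * (v k \<bullet> v l) = k * (v k \<bullet> v l)"
      using v that by simp
    then show ?thesis using that by simp
  qed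
  have inj: "inj_on v (eigenvalues B)"
    using orth v by (metis (no_types, lifting) inj_onI inner_eq_zero_iff)
  have "finite (v ` eigenvalues B)"
    using orth inj
    by (intro pairwise_orthogonal_imp_finite) (auto simp: pairwise_def orthogonal_def)
  then show ?thesis using inj finite_imageD by blast
qed

text \<open>A minimizer of the Rayleigh quotient over the unit sphere is an eigenvector of
  \<open>transpose A ** A\<close>, so the minimal quotient is an eigenvalue.\<close>

lemma rayleigh_minimum_eigenvalue:
  fixes A :: "real^'m^'d"
  obtains l where "l \<in> eigenvalues (transpose A ** A)"
    and "\<And>v. l * (norm v)\<^sup>2 \<le> (norm (A *v v))\<^sup>2"
proof -
  have "continuous_on (sphere 0 1) (\<lambda>v. norm (A *v v))"
    by (intro continuous_on_norm linear_continuous_on) simp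
  then obtain u where u: "u \<in> sphere 0 1"
      "\<And>v. v \<in> sphere 0 1 \<Longrightarrow> norm (A *v u) \<le> norm (A *v v)"
    using continuous_attains_inf[of "sphere 0 1" "\<lambda>v. norm (A *v v)"] by auto
  define l where "l = (norm (A *v u))\<^sup>2"
  have min: "l * (norm v)\<^sup>2 \<le> (norm (A *v v))\<^sup>2" for v
  proof (cases "v = 0")
    case False
    have "norm (A *v u) \<le> norm (A *v ((1 / norm v) *\<^sub>R v))"
      using False by (intro u(2)) simp
    then have "norm (A *v u) * norm v \<le> norm (A *v v)"
      using False by (simp add: matrix_vector_mult_scaleR field_simps)
    then show ?thesis
      unfolding l_def by (metis power_mono power_mult_distrib mult_nonneg_nonneg norm_ge_zero)
  qed simp
  have [simp]: "u \<noteq> 0" using u(1) by auto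
  have "w \<bullet> (transpose A *v (A *v u) - l *\<^sub>R u) = 0" for w
  proof -
    \<comment> \<open>\<open>2 * c\<close> is the derivative at \<open>u\<close>, in direction \<open>w\<close>, of a function that is minimal there.\<close>
    define c where "c = w \<bullet> (transpose A *v (A *v u) - l *\<^sub>R u)"
    define q where "q = (norm (A *v w))\<^sup>2 - l * (norm w)\<^sup>2"
    define f where "f t = t\<^sup>2 * q + 2 * t * c" for t
    have "f t = (norm (A *v (u + t *\<^sub>R w)))\<^sup>2 - l * (norm (u + t *\<^sub>R w))\<^sup>2" for t
    proof -
      have "u \<bullet> u = 1" using u(1) by (simp add: norm_eq_1)
      then show ?thesis
        unfolding f_def q_def c_def l_def power2_norm_eq_inner
        by (simp add: matrix_vector_right_distrib matrix_vector_mult_scaleR inner_add_left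
            inner_add_right inner_diff_right inner_transpose inner_commute algebra_simps
            power2_eq_square)
    qed
    then have "f 0 \<le> f t" for t using min[of "u + t *\<^sub>R w"] by (simp add: f_def)
    moreover have "(f has_real_derivative 2 * c) (at 0)"
      unfolding f_def by (auto intro!: derivative_eq_intros)
    ultimately have "2 * c = 0"
      by (intro DERIV_local_min[of f "2 * c" 0 1]) auto
    then show ?thesis by (simp add: c_def)
  qed
  then have "transpose A *v (A *v u) - l *\<^sub>R u = 0"
    by (metis inner_eq_zero_iff)
  then have "l \<in> eigenvalues (transpose A ** A)"
    unfolding eigenvalues_def
    by (auto intro!: exI[of _ u] simp flip: matrix_vector_mul_assoc)
  then show ?thesis using min by (rule that)
qed

text \<open>\<open>lambda_min\<close> is a minimum over the set of eigenvalues, which carries information only because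
  this set is finite and nonempty. Injectivity makes all eigenvalues of \<open>transpose A ** A\<close> positive.\<close>

lemma sigma_min_bound:
  fixes A :: "real^'m^'d"
  assumes "inj (\<lambda>v. A *v v)"
  shows "0 < sigma_min A" "sigma_min A * norm v \<le> norm (A *v v)"
proof -
  let ?E = "eigenvalues (transpose A ** A)"
  obtain l where l: "l \<in> ?E" "\<And>v. l * (norm v)\<^sup>2 \<le> (norm (A *v v))\<^sup>2"
    using rayleigh_minimum_eigenvalue[of A] by blast
  have fin: "finite ?E"
    by (intro finite_eigenvalues_symmetric) (simp add: matrix_transpose_mul)
  have lm: "lambda_min (transpose A ** A) = Min ?E"
    by (simp add: lambda_min_def eigenvalues_def)
  have "lambda_min (transpose A ** A) \<in> ?E"
    unfolding lm using fin l(1) by (intro Min_in) auto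
  then obtain w where w: "w \<noteq> 0"
    "transpose A *v (A *v w) = lambda_min (transpose A ** A) *\<^sub>R w"
    unfolding eigenvalues_def by (auto simp: matrix_vector_mul_assoc)
  have "(A *v w) \<bullet> (A *v w) = lambda_min (transpose A ** A) * (w \<bullet> w)"
    by (metis inner_transpose inner_scaleR_right w(2))
  moreover have "A *v w \<noteq> 0"
    using w(1) assms by (metis injD matrix_vector_mult_0_right)
  ultimately have pos: "0 < lambda_min (transpose A ** A)"
    by (metis inner_gt_zero_iff zero_less_mult_pos2 w(1))
  then show "0 < sigma_min A" by (simp add: sigma_min_def)
  have "lambda_min (transpose A ** A) * (norm v)\<^sup>2 \<le> l * (norm v)\<^sup>2"
    unfolding lm using fin l(1) by (intro mult_right_mono Min_le) auto
  also note l(2)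
  finally have "(sigma_min A * norm v)\<^sup>2 \<le> (norm (A *v v))\<^sup>2"
    using pos by (simp add: sigma_min_def power_mult_distrib)
  then show "sigma_min A * norm v \<le> norm (A *v v)"
    by (rule power2_le_imp_le) simp
qed

section \<open>The log-moment generating function of a bounded random vector\<close>

text \<open>The exponential tilting, or Esscher transform, of \<open>M\<close>.\<close>

definition tilted :: "(real^'m) measure \<Rightarrow> real^'m \<Rightarrow> (real^'m) measure" where
  "tilted M y = density M (\<lambda>u. exp (y \<bullet> u - log_mgf M y))"

definition tilted_mean :: "(real^'m) measure \<Rightarrow> real^'m \<Rightarrow> real^'m" where
  "tilted_mean M y = (\<integral>u. u \<partial>tilted M y)"

locale bounded_vector_measure = prob_space M for M :: "(real^'m) measure" +
  fixes r :: real
  assumes ident_measurable [measurable]: "(\<lambda>u. u) \<in> borel_measurable M"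
    and AE_norm_le: "AE u in M. norm u \<le> r"
begin

lemma radius_nonneg: "0 \<le> r"
proof -
  have "AE u in M. 0 \<le> r"
    using AE_norm_le by eventually_elim (meson norm_ge_zero order_trans)
  then show ?thesis by simp
qed

lemma AE_abs_inner_le: "AE u in M. \<bar>y \<bullet> u\<bar> \<le> norm y * r"
  using AE_norm_le
proof eventually_elim
  case (elim u)
  have "\<bar>y \<bullet> u\<bar> \<le> norm y * norm u" by (rule Cauchy_Schwarz_ineq2)
  with elim show ?case by (meson mult_left_mono norm_ge_zero order_trans)
qed

lemma AE_exp_bounds: "AE u in M. exp (- (norm y * r)) \<le> exp (y \<bullet> u) \<and> exp (y \<bullet> u) \<le> exp (norm y * r)"
  using AE_abs_inner_le[of y] by eventually_elim auto

lemma integrable_ident [simp]: "integrable M (\<lambda>u. u)"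
  using AE_norm_le by (rule integrable_const_bound) simp

lemma integrable_inner [simp]: "integrable M (\<lambda>u. y \<bullet> u)"
  by (intro integrable_inner_right) simp

lemma integrable_exp_inner [simp]: "integrable M (\<lambda>u. exp (y \<bullet> u))"
  by (rule integrable_const_bound[where B = "exp (norm y * r)"])
    (use AE_exp_bounds[of y] in \<open>auto elim: eventually_mono\<close>)

lemma integrable_exp_inner_ident [simp]: "integrable M (\<lambda>u. exp (y \<bullet> u) *\<^sub>R u)"
proof (rule integrable_const_bound[where B = "exp (norm y * r) * r"])
  show "AE u in M. norm (exp (y \<bullet> u) *\<^sub>R u) \<le> exp (norm y * r) * r"
    using AE_exp_bounds[of y] AE_norm_le
    by eventually_elim (auto intro!: mult_mono)
qed simp

lemma mgf_ge: "exp (- (norm y * r)) \<le> (\<integral>u. exp (y \<bullet> u) \<partial>M)"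
proof -
  have "(\<integral>u. exp (- (norm y * r)) \<partial>M) \<le> (\<integral>u. exp (y \<bullet> u) \<partial>M)"
    using AE_exp_bounds[of y] by (intro integral_mono_AE) (auto elim: eventually_mono)
  then show ?thesis by (simp add: prob_space)
qed

lemma mgf_pos: "0 < (\<integral>u. exp (y \<bullet> u) \<partial>M)"
  using mgf_ge[of y] by (rule less_le_trans[rotated]) simp

lemma exp_log_mgf: "exp (log_mgf M y) = (\<integral>u. exp (y \<bullet> u) \<partial>M)"
  by (simp add: log_mgf_def mgf_pos)

lemma norm_mean_le: "norm (\<integral>u. u \<partial>M) \<le> r"
proof -
  have "norm (\<integral>u. u \<partial>M) \<le> (\<integral>u. norm u \<partial>M)" by (rule integral_norm_bound)
  also have "\<dots> \<le> (\<integral>u. r \<partial>M)"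
    using AE_norm_le by (intro integral_mono_AE) auto
  finally show ?thesis by (simp add: prob_space)
qed

lemma integral_inner_mean: "(\<integral>u. y \<bullet> u \<partial>M) = y \<bullet> (\<integral>u. u \<partial>M)"
  by (rule integral_inner_right) simp

text \<open>Jensen's inequality for the exponential.\<close>

lemma mean_inner_le_log_mgf: "(\<integral>u. u \<partial>M) \<bullet> y \<le> log_mgf M y"
proof -
  let ?c = "y \<bullet> (\<integral>u. u \<partial>M)"
  have "(\<integral>u. 1 + (y \<bullet> u - ?c) \<partial>M) \<le> (\<integral>u. exp (- ?c) * exp (y \<bullet> u) \<partial>M)"
  proof (rule integral_mono)
    fix u :: "real^'m"
    show "1 + (y \<bullet> u - ?c) \<le> exp (- ?c) * exp (y \<bullet> u)"
      using exp_ge_add_one_self[of "y \<bullet> u - ?c"] by (simp add: exp_diff exp_minus field_simps)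
  qed auto
  then have "1 \<le> exp (- ?c) * exp (log_mgf M y)"
    by (simp add: prob_space integral_inner_mean exp_log_mgf)
  then have "exp 0 \<le> exp (- ?c + log_mgf M y)"
    by (simp only: exp_add exp_zero)
  then show ?thesis by (simp add: inner_commute)
qed

text \<open>Hoeffding's lemma: the variable \<open>y \<bullet> u\<close> ranges over an interval of length \<open>2 * norm y * r\<close>, and
  one eighth of the square of this length is \<open>r\<^sup>2 / 2 * (norm y)\<^sup>2\<close>.\<close>

lemma log_mgf_le: "log_mgf M y \<le> (\<integral>u. u \<partial>M) \<bullet> y + r\<^sup>2 / 2 * (norm y)\<^sup>2"
proof -
  let ?c = "y \<bullet> (\<integral>u. u \<partial>M)"
  interpret Y: interval_bounded_random_variable M "\<lambda>u. y \<bullet> u" "- (norm y * r)" "norm y * r"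
    by unfold_locales (use AE_abs_inner_le[of y] in \<open>auto elim: eventually_mono\<close>)
  have "(\<integral>\<^sup>+u. ennreal (exp (1 * (y \<bullet> u - ?c))) \<partial>M)
      \<le> ennreal (exp (1\<^sup>2 * (norm y * r - - (norm y * r))\<^sup>2 / 8))"
    using Y.Hoeffdings_lemma_nn_integral[of 1] by (simp add: integral_inner_mean)
  also have "(1\<^sup>2 * (norm y * r - - (norm y * r))\<^sup>2 / 8) = r\<^sup>2 / 2 * (norm y)\<^sup>2"
    by (simp add: power2_eq_square)
  also have "(\<integral>\<^sup>+u. ennreal (exp (1 * (y \<bullet> u - ?c))) \<partial>M)
      = ennreal (\<integral>u. exp (- ?c) * exp (y \<bullet> u) \<partial>M)"
    by (subst nn_integral_eq_integral[symmetric]) (auto simp: exp_diff exp_minus field_simps)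
  finally have "exp (- ?c) * exp (log_mgf M y) \<le> exp (r\<^sup>2 / 2 * (norm y)\<^sup>2)"
    by (simp add: exp_log_mgf)
  then have "- ?c + log_mgf M y \<le> r\<^sup>2 / 2 * (norm y)\<^sup>2"
    by (metis exp_add exp_le_cancel_iff)
  then show ?thesis by (simp add: inner_commute)
qed

lemma space_tilted [simp]: "space (tilted M y) = space M"
  and sets_tilted [simp]: "sets (tilted M y) = sets M"
  by (simp_all add: tilted_def)

lemma integral_tilted:
  fixes f :: "real^'m \<Rightarrow> 'b::{banach, second_countable_topology}"
  assumes [measurable]: "f \<in> borel_measurable M"
  shows "(\<integral>u. f u \<partial>tilted M y) = (\<integral>u. exp (y \<bullet> u - log_mgf M y) *\<^sub>R f u \<partial>M)"
  unfolding tilted_def by (rule integral_density) auto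

lemma prob_space_tilted: "prob_space (tilted M y)"
proof
  have "emeasure (tilted M y) (space (tilted M y))
      = (\<integral>\<^sup>+u. ennreal (exp (y \<bullet> u - log_mgf M y)) \<partial>M)"
    by (simp add: tilted_def emeasure_density cong: nn_integral_cong)
  also have "\<dots> = ennreal (\<integral>u. exp (- log_mgf M y) * exp (y \<bullet> u) \<partial>M)"
    by (subst nn_integral_eq_integral[symmetric]) (auto simp: exp_diff exp_minus field_simps)
  also have "(\<integral>u. exp (- log_mgf M y) * exp (y \<bullet> u) \<partial>M) = 1"
    by (simp add: exp_log_mgf[symmetric] exp_minus)
  finally show "emeasure (tilted M y) (space (tilted M y)) = 1" by simp
qed

lemma bounded_vector_measure_tilted: "bounded_vector_measure (tilted M y) r"
proof -
  interpret T: prob_space "tilted M y" by (rule prob_space_tilted)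
  show ?thesis
  proof
    show "(\<lambda>u. u) \<in> borel_measurable (tilted M y)"
      unfolding tilted_def by simp
    show "AE u in tilted M y. norm u \<le> r"
      unfolding tilted_def using AE_norm_le by (subst AE_density) (auto elim: eventually_mono)
  qed
qed

text \<open>Tilting by \<open>y\<close> translates the log-moment generating function by \<open>y\<close>, so every inequality
  at the origin holds at every point, with the mean replaced by the tilted mean.\<close>

lemma log_mgf_tilted: "log_mgf (tilted M y) h = log_mgf M (y + h) - log_mgf M y"
proof -
  have "(\<integral>u. exp (h \<bullet> u) \<partial>tilted M y) = (\<integral>u. exp (- log_mgf M y) * exp ((y + h) \<bullet> u) \<partial>M)"
    by (subst integral_tilted)
      (auto intro!: Bochner_Integration.integral_cong simp: inner_add_left simp flip: exp_add)
  also have "\<dots> = exp (- log_mgf M y) * exp (log_mgf M (y + h))"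
    by (simp add: exp_log_mgf)
  also have "\<dots> = exp (log_mgf M (y + h) - log_mgf M y)"
    by (simp flip: exp_add)
  finally show ?thesis by (simp add: log_mgf_def[of "tilted M y"])
qed

lemma norm_tilted_mean_le: "norm (tilted_mean M y) \<le> r"
  unfolding tilted_mean_def
  by (rule bounded_vector_measure.norm_mean_le[OF bounded_vector_measure_tilted])

lemma log_mgf_tangent: "log_mgf M y + tilted_mean M y \<bullet> h \<le> log_mgf M (y + h)"
  using bounded_vector_measure.mean_inner_le_log_mgf[OF bounded_vector_measure_tilted, of y h]
  by (simp add: log_mgf_tilted tilted_mean_def)

lemma log_mgf_quadratic_upper:
  "log_mgf M (y + h) \<le> log_mgf M y + tilted_mean M y \<bullet> h + r\<^sup>2 / 2 * (norm h)\<^sup>2"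
  using bounded_vector_measure.log_mgf_le[OF bounded_vector_measure_tilted, of y h]
  by (simp add: log_mgf_tilted tilted_mean_def)

lemma GDERIV_log_mgf: "GDERIV (log_mgf M) y :> tilted_mean M y"
  using log_mgf_tangent log_mgf_quadratic_upper by (rule quadratic_bounds_imp_GDERIV)

lemma grad_log_mgf: "grad (log_mgf M) y = tilted_mean M y"
  by (rule grad_eqI[OF GDERIV_log_mgf])

lemma tilted_mean_lipschitz: "norm (tilted_mean M x - tilted_mean M y) \<le> r\<^sup>2 * norm (x - y)"
proof (cases "r = 0")
  \<comment> \<open>The cocoercivity argument divides by \<open>r\<^sup>2\<close>; for \<open>r = 0\<close> all tilted means are \<open>0\<close>.\<close>
  case True
  then show ?thesis using norm_tilted_mean_le[of x] norm_tilted_mean_le[of y] by simp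
next
  case False
  then show ?thesis
    using quadratic_bounds_imp_gradient_lipschitz[OF log_mgf_tangent log_mgf_quadratic_upper]
    by simp
qed

text \<open>Both endpoints lie above the tangent at the intermediate point.\<close>

lemma convex_log_mgf:
  assumes "0 \<le> t" "t \<le> 1"
  shows "log_mgf M ((1 - t) *\<^sub>R x + t *\<^sub>R y) \<le> (1 - t) * log_mgf M x + t * log_mgf M y"
proof -
  define w where "w = (1 - t) *\<^sub>R x + t *\<^sub>R y"
  let ?p = "tilted_mean M w"
  have "(1 - t) * (log_mgf M w + ?p \<bullet> (x - w)) + t * (log_mgf M w + ?p \<bullet> (y - w))
      \<le> (1 - t) * log_mgf M x + t * log_mgf M y"
    using log_mgf_tangent[of w "x - w"] log_mgf_tangent[of w "y - w"] assms
    by (intro add_mono mult_left_mono) auto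
  moreover have "(1 - t) * (?p \<bullet> (x - w)) + t * (?p \<bullet> (y - w)) = 0"
  proof -
    have "(1 - t) *\<^sub>R (x - w) + t *\<^sub>R (y - w) = 0"
      unfolding w_def by (simp add: algebra_simps)
    then show ?thesis by (metis inner_add_right inner_scaleR_right inner_zero_right)
  qed
  ultimately show ?thesis unfolding w_def[symmetric] by (simp add: algebra_simps)
qed

lemma isCont_log_mgf: "isCont (log_mgf M) y"
  using GDERIV_log_mgf[of y] unfolding gderiv_def by (rule has_derivative_continuous)

lemma tilted_mean_eq_quotient:
  "tilted_mean M y = (\<integral>u. exp (y \<bullet> u) *\<^sub>R u \<partial>M) /\<^sub>R (\<integral>u. exp (y \<bullet> u) \<partial>M)"
proof -
  have "tilted_mean M y = (\<integral>u. exp (- log_mgf M y) *\<^sub>R (exp (y \<bullet> u) *\<^sub>R u) \<partial>M)"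
    unfolding tilted_mean_def
    by (subst integral_tilted) (auto simp: exp_diff exp_minus field_simps)
  also have "\<dots> = exp (- log_mgf M y) *\<^sub>R (\<integral>u. exp (y \<bullet> u) *\<^sub>R u \<partial>M)"
    by (rule integral_scaleR_right)
  finally show ?thesis by (simp add: exp_minus exp_log_mgf)
qed

lemma integral_exp_inner_deviation:
  "(\<integral>u. exp (y \<bullet> u) *\<^sub>R (u - q) \<partial>M) = (\<integral>u. exp (y \<bullet> u) \<partial>M) *\<^sub>R (tilted_mean M y - q)"
  using mgf_pos[of y] by (simp add: tilted_mean_eq_quotient scaleR_diff_right)

end

section \<open>The dual problem\<close>

lemma le_of_le_add_small_multiple:
  fixes x y c :: real
  assumes "\<And>t. 0 < t \<Longrightarrow> t < 1 \<Longrightarrow> x \<le> y + t * c"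
  shows "x \<le> y"
proof (rule tendsto_lowerbound)
  show "((\<lambda>t. y + t * c) \<longlongrightarrow> y) (at_right 0)"
    by (auto intro!: tendsto_eq_intros)
  show "\<forall>\<^sub>F t in at_right 0. x \<le> y + t * c"
    unfolding eventually_at_right_field using assms by (intro exI[of _ 1]) auto
qed simp

locale smooth_mem_problem =
  fixes g :: "real^'d \<Rightarrow> real" and A :: "real^'m^'d" and b :: "real^'d" and \<alpha> \<beta> :: real
  assumes \<alpha>_pos: "\<alpha> > 0" and \<beta>_pos: "\<beta> > 0"
    and convex_g: "convex_on UNIV g"
    and differentiable_g: "\<And>y. g differentiable (at y)"
    and lipschitz_grad_g: "(1 / \<beta>)-lipschitz_on UNIV (grad g)"
begin

lemma GDERIV_g: "GDERIV g x :> grad g x"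
  by (rule GDERIV_grad[OF differentiable_g])

lemma g_tangent: "g x + grad g x \<bullet> d \<le> g (x + d)"
  by (rule convex_on_tangent_le[OF convex_g GDERIV_g])

lemma g_quadratic_upper: "g (x + d) \<le> g x + grad g x \<bullet> d + 1 / (2 * \<beta>) * (norm d)\<^sup>2"
  using descent_lemma[of g "grad g" "1 / \<beta>" x d] GDERIV_g lipschitz_grad_g
  by (simp add: lipschitz_on_def dist_norm)

text \<open>The summand \<open>\<alpha> * g\<^sup>*(- z / \<alpha>) - b \<bullet> z\<close> of the dual objective is the supremum over \<open>x\<close> of
  \<open>dual_pairing z x\<close>. Keeping it as a real-valued function on the set where the supremum is finite
  removes extended real arithmetic from the rest of the argument.\<close>

definition dual_pairing :: "real^'d \<Rightarrow> real^'d \<Rightarrow> real" where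
  "dual_pairing z x = - (z \<bullet> (x + b)) - \<alpha> * g x"

definition dual_domain :: "(real^'d) set" where
  "dual_domain = {z. bdd_above (range (dual_pairing z))}"

definition conj_term :: "real^'d \<Rightarrow> real" where
  "conj_term z = (SUP x. dual_pairing z x)"

definition dual_value :: "(real^'m) measure \<Rightarrow> real^'d \<Rightarrow> real" where
  "dual_value M z = conj_term z + log_mgf M (transpose A *v z)"

definition dual_minimizer :: "(real^'m) measure \<Rightarrow> real^'d \<Rightarrow> bool" where
  "dual_minimizer M z \<longleftrightarrow> z \<in> dual_domain \<and> (\<forall>w\<in>dual_domain. dual_value M z \<le> dual_value M w)"

lemma conj_term_le_iff: "z \<in> dual_domain \<and> conj_term z \<le> c \<longleftrightarrow> (\<forall>x. dual_pairing z x \<le> c)"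
proof
  show "z \<in> dual_domain \<and> conj_term z \<le> c \<Longrightarrow> \<forall>x. dual_pairing z x \<le> c"
    unfolding dual_domain_def conj_term_def by (auto intro: cSUP_upper order_trans)
  show "\<forall>x. dual_pairing z x \<le> c \<Longrightarrow> z \<in> dual_domain \<and> conj_term z \<le> c"
    unfolding dual_domain_def conj_term_def by (auto intro!: cSUP_least bdd_aboveI)
qed

lemma dual_pairing_le: "z \<in> dual_domain \<Longrightarrow> dual_pairing z x \<le> conj_term z"
  using conj_term_le_iff[of z "conj_term z"] by simp

lemma dual_obj_le_iff:
  "dual_obj g A b \<alpha> M z \<le> ereal c \<longleftrightarrow> z \<in> dual_domain \<and> dual_value M z \<le> c"
proof -
  let ?l = "log_mgf M (transpose A *v z)"
  have "dual_obj g A b \<alpha> M z \<le> ereal c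
      \<longleftrightarrow> fenchel_conj g (- (z /\<^sub>R \<alpha>)) \<le> ereal ((c - ?l + b \<bullet> z) / \<alpha>)"
    unfolding dual_obj_def
    using \<alpha>_pos by (cases "fenchel_conj g (- (z /\<^sub>R \<alpha>))") (auto simp: field_simps)
  also have "\<dots> \<longleftrightarrow> (\<forall>x. dual_pairing z x \<le> c - ?l)"
    unfolding fenchel_conj_def
  proof (simp only: SUP_le_iff ereal_less_eq UNIV_I ball_UNIV simp_thms, intro iff_allI)
    fix x
    have "(- (z /\<^sub>R \<alpha>) \<bullet> x - g x) * \<alpha> = dual_pairing z x + b \<bullet> z"
      using \<alpha>_pos by (simp add: dual_pairing_def inner_add_right inner_commute left_diff_distrib)
    then show "- (z /\<^sub>R \<alpha>) \<bullet> x - g x \<le> (c - ?l + b \<bullet> z) / \<alpha> \<longleftrightarrow> dual_pairing z x \<le> c - ?l"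
      using \<alpha>_pos by (simp only: pos_le_divide_eq) auto
  qed
  finally show ?thesis
    using conj_term_le_iff[of z "c - ?l"] by (simp add: dual_value_def algebra_simps)
qed

lemma dual_obj_eq: "z \<in> dual_domain \<Longrightarrow> dual_obj g A b \<alpha> M z = ereal (dual_value M z)"
proof (rule antisym)
  show "z \<in> dual_domain \<Longrightarrow> dual_obj g A b \<alpha> M z \<le> ereal (dual_value M z)"
    by (simp add: dual_obj_le_iff)
  show "ereal (dual_value M z) \<le> dual_obj g A b \<alpha> M z"
    by (rule ereal_le_real) (simp add: dual_obj_le_iff)
qed

text \<open>At \<open>z = - \<alpha> *\<^sub>R grad g x\<close> the function \<open>dual_pairing z\<close> is concave with zero gradient at \<open>x\<close>, so its
  supremum is attained there. In particular the dual problem is feasible.\<close>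

lemma slope_in_dual_domain:
  "- (\<alpha> *\<^sub>R grad g x) \<in> dual_domain"
  "conj_term (- (\<alpha> *\<^sub>R grad g x)) \<le> dual_pairing (- (\<alpha> *\<^sub>R grad g x)) x"
proof -
  have "dual_pairing (- (\<alpha> *\<^sub>R grad g x)) y \<le> dual_pairing (- (\<alpha> *\<^sub>R grad g x)) x" for y
  proof -
    have "\<alpha> * (g x + grad g x \<bullet> (y - x)) \<le> \<alpha> * g y"
      using g_tangent[of x "y - x"] \<alpha>_pos by simp
    then show ?thesis
      by (simp add: dual_pairing_def inner_diff_right inner_add_right algebra_simps)
  qed
  then show "- (\<alpha> *\<^sub>R grad g x) \<in> dual_domain"
    "conj_term (- (\<alpha> *\<^sub>R grad g x)) \<le> dual_pairing (- (\<alpha> *\<^sub>R grad g x)) x"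
    using conj_term_le_iff by blast+
qed

lemma dual_solution_imp_minimizer:
  assumes "dual_solution g A b \<alpha> M z"
  shows "dual_minimizer M z"
proof -
  have *: "dual_obj g A b \<alpha> M z \<le> ereal (dual_value M w)" if "w \<in> dual_domain" for w
    using assms dual_obj_eq[OF that, of M]
    unfolding dual_solution_def is_arg_min_def by (metis not_less)
  then show ?thesis
    using slope_in_dual_domain(1) unfolding dual_minimizer_def dual_obj_le_iff by blast
qed

lemma approx_dual_solutionsD:
  assumes "z \<in> approx_dual_solutions g A b \<alpha> M \<epsilon>" "w \<in> dual_domain"
  shows "z \<in> dual_domain" "dual_value M z \<le> dual_value M w + \<epsilon>"
proof -
  have "dual_obj g A b \<alpha> M z \<le> (INF w. dual_obj g A b \<alpha> M w) + ereal \<epsilon>"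
    using assms(1) by (simp add: approx_dual_solutions_def)
  also have "\<dots> \<le> dual_obj g A b \<alpha> M w + ereal \<epsilon>"
    by (intro add_right_mono INF_lower) simp
  also have "\<dots> = ereal (dual_value M w + \<epsilon>)"
    using assms(2) by (simp add: dual_obj_eq)
  finally show "z \<in> dual_domain" "dual_value M z \<le> dual_value M w + \<epsilon>"
    by (simp_all add: dual_obj_le_iff)
qed

text \<open>Smoothness of \<open>g\<close> makes its conjugate strongly convex: in a convex combination of two
  suprema the arguments may be chosen as \<open>x + t *\<^sub>R s\<close> and \<open>x - (1 - t) *\<^sub>R s\<close>. The first-order
  terms of the quadratic upper bounds at \<open>x\<close> cancel, and optimizing over \<open>s\<close> gives the quadratic
  gain.\<close>

lemma conj_term_strongly_convex:
  assumes z: "z \<in> dual_domain" and w: "w \<in> dual_domain" and t: "0 \<le> t" "t \<le> 1"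
  defines "v \<equiv> (1 - t) *\<^sub>R z + t *\<^sub>R w"
  shows "v \<in> dual_domain"
    and "conj_term v \<le> (1 - t) * conj_term z + t * conj_term w
           - \<beta> / (2 * \<alpha>) * (t * (1 - t)) * (norm (z - w))\<^sup>2"
proof -
  \<comment> \<open>The maximizer of the concave quadratic in \<open>s\<close> that remains below.\<close>
  define s where "s = - ((\<beta> / \<alpha>) *\<^sub>R (z - w))"
  have "dual_pairing v x \<le> (1 - t) * conj_term z + t * conj_term w
      - \<beta> / (2 * \<alpha>) * (t * (1 - t)) * (norm (z - w))\<^sup>2" for x
  proof -
    define q where "q = \<alpha> / (2 * \<beta>) * (norm s)\<^sup>2"
    \<comment> \<open>Used with \<open>c = t\<close> at \<open>z\<close> and \<open>c = t - 1\<close> at \<open>w\<close>, so that the terms in \<open>grad g x\<close> cancel.\<close>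
    have pair: "dual_pairing y x - y \<bullet> (c *\<^sub>R s) - \<alpha> * c * (grad g x \<bullet> s) - c\<^sup>2 * q
        \<le> conj_term y" if "y \<in> dual_domain" for y c
    proof -
      have "\<alpha> * g (x + c *\<^sub>R s)
          \<le> \<alpha> * (g x + grad g x \<bullet> (c *\<^sub>R s) + 1 / (2 * \<beta>) * (norm (c *\<^sub>R s))\<^sup>2)"
        using \<alpha>_pos by (intro mult_left_mono g_quadratic_upper) auto
      then show ?thesis
        using dual_pairing_le[OF that, of "x + c *\<^sub>R s"]
        by (simp add: dual_pairing_def q_def inner_add_right power_mult_distrib algebra_simps)
    qed
    have "(1 - t) * (dual_pairing z x - z \<bullet> (t *\<^sub>R s) - \<alpha> * t * (grad g x \<bullet> s) - t\<^sup>2 * q)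
        + t * (dual_pairing w x - w \<bullet> ((t - 1) *\<^sub>R s) - \<alpha> * (t - 1) * (grad g x \<bullet> s) - (t - 1)\<^sup>2 * q)
        \<le> (1 - t) * conj_term z + t * conj_term w"
      using t by (intro add_mono mult_left_mono pair z w) auto
    moreover have "dual_pairing v x = (1 - t) * dual_pairing z x + t * dual_pairing w x"
      by (simp add: dual_pairing_def v_def inner_add_left algebra_simps)
    ultimately have "dual_pairing v x - (t * (1 - t)) * ((z - w) \<bullet> s) - (t * (1 - t)) * q
        \<le> (1 - t) * conj_term z + t * conj_term w"
      by (simp add: inner_diff_left power2_eq_square algebra_simps)
    moreover have "(z - w) \<bullet> s = - 2 * (\<beta> / (2 * \<alpha>) * (norm (z - w))\<^sup>2)"
      by (simp add: s_def power2_norm_eq_inner)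
    moreover have "q = \<beta> / (2 * \<alpha>) * (norm (z - w))\<^sup>2"
    proof -
      have "(norm s)\<^sup>2 = (\<beta> / \<alpha>)\<^sup>2 * (norm (z - w))\<^sup>2"
        using \<alpha>_pos \<beta>_pos by (simp add: s_def power_mult_distrib power_divide)
      then show ?thesis
        unfolding q_def using \<alpha>_pos \<beta>_pos by (simp add: field_simps power2_eq_square)
    qed
    ultimately have "dual_pairing v x
        + (t * (1 - t)) * (\<beta> / (2 * \<alpha>) * (norm (z - w))\<^sup>2) \<le> (1 - t) * conj_term z + t * conj_term w"
      by (simp only: mult_minus_left mult_minus_right)
    then show ?thesis by (simp only: mult_ac)
  qed
  then show "v \<in> dual_domain" "conj_term v \<le> (1 - t) * conj_term z + t * conj_term w
      - \<beta> / (2 * \<alpha>) * (t * (1 - t)) * (norm (z - w))\<^sup>2"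
    using conj_term_le_iff by blast+
qed

lemma conj_term_lower_semicontinuous:
  assumes "\<And>k. zs k \<in> dual_domain" "\<And>k. conj_term (zs k) \<le> cs k"
    and "zs \<longlonglongrightarrow> z" "cs \<longlonglongrightarrow> c"
  shows "z \<in> dual_domain" "conj_term z \<le> c"
proof -
  have "dual_pairing z x \<le> c" for x
  proof (rule LIMSEQ_le)
    show "(\<lambda>k. dual_pairing (zs k) x) \<longlonglongrightarrow> dual_pairing z x"
      unfolding dual_pairing_def by (intro tendsto_intros assms)
    show "\<exists>N. \<forall>k\<ge>N. dual_pairing (zs k) x \<le> cs k"
      using assms(1,2) dual_pairing_le order_trans by blast
  qed (rule assms)
  then show "z \<in> dual_domain" "conj_term z \<le> c"
    using conj_term_le_iff by blast+
qed

end

locale mem_problem_measure =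
  smooth_mem_problem g A b \<alpha> \<beta> + bounded_vector_measure M r
  for g :: "real^'d \<Rightarrow> real" and A :: "real^'m^'d" and b \<alpha> \<beta> and M :: "(real^'m) measure" and r
begin

lemma dual_value_strongly_convex:
  assumes "z \<in> dual_domain" "w \<in> dual_domain" "0 \<le> t" "t \<le> 1"
  shows "dual_value M ((1 - t) *\<^sub>R z + t *\<^sub>R w) \<le> (1 - t) * dual_value M z + t * dual_value M w
           - \<beta> / (2 * \<alpha>) * (t * (1 - t)) * (norm (z - w))\<^sup>2"
  using conj_term_strongly_convex(2)[OF assms]
    convex_log_mgf[OF assms(3,4), of "transpose A *v z" "transpose A *v w"]
  by (simp add: dual_value_def matrix_vector_right_distrib matrix_vector_mult_scaleR algebra_simps)

text \<open>Weak duality: minus the primal objective at the mean of \<open>M\<close>, where the entropy vanishes,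
  bounds the dual objective from below.\<close>

lemma dual_value_bounded_below:
  assumes "z \<in> dual_domain"
  shows "- \<alpha> * g (A *v (\<integral>u. u \<partial>M) - b) \<le> dual_value M z"
  using dual_pairing_le[OF assms, of "A *v (\<integral>u. u \<partial>M) - b"]
    mean_inner_le_log_mgf[of "transpose A *v z"]
  by (simp add: dual_value_def dual_pairing_def inner_transpose inner_commute)

text \<open>By strong convexity at the midpoint every minimizing sequence is Cauchy, and by lower
  semicontinuity its limit is a minimizer.\<close>

lemma dual_minimizer_exists: "\<exists>z. dual_minimizer M z"
proof -
  define i where "i = (INF z\<in>dual_domain. dual_value M z)"
  have ne: "dual_domain \<noteq> {}" using slope_in_dual_domain(1) by blast
  have bdd: "bdd_below (dual_value M ` dual_domain)"
    using dual_value_bounded_below by (intro bdd_belowI) auto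
  have i_le: "i \<le> dual_value M z" if "z \<in> dual_domain" for z
    unfolding i_def using bdd that by (rule cINF_lower)
  have "\<exists>z\<in>dual_domain. dual_value M z < i + inverse (real (Suc k))" for k
  proof -
    have "i < i + inverse (real (Suc k))" by simp
    then show ?thesis
      unfolding i_def using ne bdd by (subst (asm) cINF_less_iff) auto
  qed
  then obtain zs where zs: "\<And>k. zs k \<in> dual_domain"
      "\<And>k. dual_value M (zs k) < i + inverse (real (Suc k))"
    by metis
  have dist_le: "\<beta> / (8 * \<alpha>) * (norm (zs k - zs l))\<^sup>2 \<le> inverse (real (Suc N))"
    if "N \<le> k" "N \<le> l" for k l N
  proof -
    let ?w = "(1 - 1/2) *\<^sub>R zs k + (1/2) *\<^sub>R zs l"
    have "?w \<in> dual_domain" by (rule conj_term_strongly_convex(1)[OF zs(1) zs(1)]) auto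
    then have "i \<le> dual_value M ?w" by (rule i_le)
    also have "\<dots> \<le> (1 - 1/2) * dual_value M (zs k) + 1/2 * dual_value M (zs l)
        - \<beta> / (2 * \<alpha>) * (1/2 * (1 - 1/2)) * (norm (zs k - zs l))\<^sup>2"
      by (rule dual_value_strongly_convex[OF zs(1) zs(1)]) auto
    finally have gain: "\<beta> / (8 * \<alpha>) * (norm (zs k - zs l))\<^sup>2
        \<le> (dual_value M (zs k) + dual_value M (zs l)) / 2 - i"
      by (simp add: field_simps)
    have "dual_value M (zs j) \<le> i + inverse (real (Suc N))" if "N \<le> j" for j
    proof -
      have "inverse (real (Suc j)) \<le> inverse (real (Suc N))" using that by simp
      with zs(2)[of j] show ?thesis by linarith
    qed
    from this[OF that(1)] this[OF that(2)]
    have "(dual_value M (zs k) + dual_value M (zs l)) / 2 - i \<le> inverse (real (Suc N))"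
      by (simp add: field_simps)
    with gain show ?thesis by (rule order_trans)
  qed
  have "Cauchy zs"
  proof (rule metric_CauchyI)
    fix e :: real assume "e > 0"
    then have "\<beta> / (8 * \<alpha>) * e\<^sup>2 > 0" using \<alpha>_pos \<beta>_pos by simp
    then obtain N where N: "inverse (real (Suc N)) < \<beta> / (8 * \<alpha>) * e\<^sup>2"
      using reals_Archimedean by blast
    have "dist (zs k) (zs l) < e" if "N \<le> k" "N \<le> l" for k l
    proof -
      have "\<beta> / (8 * \<alpha>) * (norm (zs k - zs l))\<^sup>2 < \<beta> / (8 * \<alpha>) * e\<^sup>2"
        using dist_le[OF that] N by linarith
      then have "(norm (zs k - zs l))\<^sup>2 < e\<^sup>2"
        using \<alpha>_pos \<beta>_pos by (subst (asm) mult_less_cancel_left_pos) auto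
      then show ?thesis
        using \<open>e > 0\<close> by (simp add: dist_norm power2_less_imp_less)
    qed
    then show "\<exists>N. \<forall>k\<ge>N. \<forall>l\<ge>N. dist (zs k) (zs l) < e" by blast
  qed
  then obtain z where z: "zs \<longlonglongrightarrow> z"
    using Cauchy_convergent convergent_def by blast
  have "(\<lambda>k. transpose A *v zs k) \<longlonglongrightarrow> transpose A *v z"
    by (intro bounded_linear.tendsto[OF matrix_vector_mul_bounded_linear] z)
  then have L: "(\<lambda>k. log_mgf M (transpose A *v zs k)) \<longlonglongrightarrow> log_mgf M (transpose A *v z)"
    by (rule isCont_tendsto_compose[OF isCont_log_mgf])
  have lim: "(\<lambda>k. i + inverse (real (Suc k)) - log_mgf M (transpose A *v zs k))
      \<longlonglongrightarrow> i + 0 - log_mgf M (transpose A *v z)"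
    by (intro tendsto_intros L LIMSEQ_inverse_real_of_nat)
  have upper: "conj_term (zs k) \<le> i + inverse (real (Suc k)) - log_mgf M (transpose A *v zs k)" for k
    using zs(2)[of k] by (simp add: dual_value_def)
  have "z \<in> dual_domain" "conj_term z \<le> i + 0 - log_mgf M (transpose A *v z)"
    by (rule conj_term_lower_semicontinuous[OF zs(1) upper z lim])+
  then have "z \<in> dual_domain" "dual_value M z \<le> i" by (simp_all add: dual_value_def)
  then have "dual_minimizer M z"
    unfolding dual_minimizer_def using i_le order_trans by blast
  then show ?thesis ..
qed

text \<open>First-order optimality, with the quadratic gain from strong convexity. The smooth summand of the
  dual objective has the gradient \<open>A *v tilted_mean M (transpose A *v z)\<close> at \<open>z\<close>, so at the minimizer
  the negative of this vector is a subgradient of \<open>conj_term\<close>. The proof moves from \<open>z\<close> towards \<open>w\<close>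
  by a fraction \<open>t\<close>, divides by \<open>t\<close> and lets \<open>t\<close> tend to \<open>0\<close>.\<close>

lemma dual_minimizer_variational:
  assumes z: "dual_minimizer M z" and w: "w \<in> dual_domain"
  shows "conj_term z - (A *v tilted_mean M (transpose A *v z)) \<bullet> (w - z)
           + \<beta> / (2 * \<alpha>) * (norm (w - z))\<^sup>2 \<le> conj_term w"
proof (rule le_of_le_add_small_multiple)
  fix t :: real assume t: "0 < t" "t < 1"
  have z': "z \<in> dual_domain" using z by (simp add: dual_minimizer_def)
  define D where "D = \<beta> / (2 * \<alpha>) * (norm (w - z))\<^sup>2"
  define k where "k = transpose A *v (w - z)"
  define p where "p = tilted_mean M (transpose A *v z)"
  define v where "v = (1 - t) *\<^sub>R z + t *\<^sub>R w"
  have v: "v \<in> dual_domain"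
    unfolding v_def using z' w t by (intro conj_term_strongly_convex(1)) auto
  have "conj_term v \<le> (1 - t) * conj_term z + t * conj_term w - t * (1 - t) * D"
    using conj_term_strongly_convex(2)[OF z' w, of t] t
    by (simp add: v_def D_def norm_minus_commute mult_ac)
  moreover have "transpose A *v v = transpose A *v z + t *\<^sub>R k"
    by (simp add: v_def k_def matrix_vector_right_distrib matrix_vector_mult_scaleR
        matrix_vector_mult_diff_distrib algebra_simps)
  then have "log_mgf M (transpose A *v v)
      \<le> log_mgf M (transpose A *v z) + p \<bullet> (t *\<^sub>R k) + r\<^sup>2 / 2 * (norm (t *\<^sub>R k))\<^sup>2"
    using log_mgf_quadratic_upper[of "transpose A *v z" "t *\<^sub>R k"] by (simp add: p_def)
  moreover have "dual_value M z \<le> dual_value M v"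
    using z v by (simp add: dual_minimizer_def)
  ultimately have "t * conj_term z \<le> t * conj_term w - t * (1 - t) * D + t * (p \<bullet> k)
      + r\<^sup>2 / 2 * (norm (t *\<^sub>R k))\<^sup>2"
    by (simp add: dual_value_def algebra_simps)
  also have "\<dots> = t * (conj_term w - (1 - t) * D + p \<bullet> k + t * (r\<^sup>2 / 2 * (norm k)\<^sup>2))"
    by (simp add: power_mult_distrib algebra_simps power2_eq_square)
  finally have "conj_term z \<le> conj_term w - (1 - t) * D + p \<bullet> k + t * (r\<^sup>2 / 2 * (norm k)\<^sup>2)"
    using t by simp
  moreover have "p \<bullet> k = (A *v p) \<bullet> (w - z)"
    unfolding k_def by (rule inner_transpose)
  ultimately show "conj_term z - (A *v tilted_mean M (transpose A *v z)) \<bullet> (w - z)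
      + \<beta> / (2 * \<alpha>) * (norm (w - z))\<^sup>2 \<le> conj_term w + t * (D + r\<^sup>2 / 2 * (norm k)\<^sup>2)"
    unfolding p_def[symmetric] D_def[symmetric] by (simp add: algebra_simps)
qed

text \<open>Quadratic growth at the minimizer: the first-order terms of the variational inequality and of the
  tangent inequality for the log-moment generating function cancel.\<close>

lemma approx_minimizer_close:
  assumes z: "dual_minimizer M z" and w: "w \<in> dual_domain" "dual_value M w \<le> dual_value M z + \<epsilon>"
  shows "norm (w - z) \<le> sqrt (2 * \<alpha> / \<beta> * \<epsilon>)"
proof (rule real_le_rsqrt)
  let ?p = "tilted_mean M (transpose A *v z)"
  have "log_mgf M (transpose A *v z) + ?p \<bullet> (transpose A *v (w - z)) \<le> log_mgf M (transpose A *v w)"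
    using log_mgf_tangent[of "transpose A *v z" "transpose A *v (w - z)"]
    by (simp add: matrix_vector_mult_diff_distrib)
  then have "\<beta> / (2 * \<alpha>) * (norm (w - z))\<^sup>2 \<le> \<epsilon>"
    using dual_minimizer_variational[OF z w(1)] w(2)
    by (simp add: dual_value_def inner_transpose)
  then show "(norm (w - z))\<^sup>2 \<le> 2 * \<alpha> / \<beta> * \<epsilon>"
    using \<alpha>_pos \<beta>_pos by (simp add: field_simps)
qed

text \<open>The optimality condition that links the dual minimizer to the primal candidate
  \<open>tilted_mean M (transpose A *v z)\<close>. Testing the variational inequality with
  \<open>w = - \<alpha> *\<^sub>R grad g q\<close>, where the supremum in \<open>conj_term w\<close> is attained at \<open>q\<close>, gives equality in the
  Fenchel-Young inequality for \<open>- z / \<alpha>\<close> and \<open>q\<close>; so \<open>- z / \<alpha>\<close> is a subgradient of \<open>g\<close> at \<open>q\<close>.\<close>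

lemma dual_minimizer_eq_grad:
  assumes z: "dual_minimizer M z"
  shows "- (z /\<^sub>R \<alpha>) = grad g (A *v tilted_mean M (transpose A *v z) - b)"
proof (rule subgradient_eq_GDERIV[OF GDERIV_g])
  define q where "q = A *v tilted_mean M (transpose A *v z) - b"
  define w where "w = - (\<alpha> *\<^sub>R grad g q)"
  fix d
  have "conj_term z \<le> dual_pairing w q + (q + b) \<bullet> (w - z)"
  proof -
    have "conj_term z \<le> conj_term w + (q + b) \<bullet> (w - z) - \<beta> / (2 * \<alpha>) * (norm (w - z))\<^sup>2"
      using dual_minimizer_variational[OF z slope_in_dual_domain(1), of q] by (simp add: q_def w_def)
    also have "\<dots> \<le> conj_term w + (q + b) \<bullet> (w - z)"
      using \<alpha>_pos \<beta>_pos by simp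
    also have "\<dots> \<le> dual_pairing w q + (q + b) \<bullet> (w - z)"
      using slope_in_dual_domain(2)[of q] by (simp add: w_def)
    finally show ?thesis .
  qed
  moreover have "dual_pairing z (q + d) \<le> conj_term z"
    using z by (intro dual_pairing_le) (simp add: dual_minimizer_def)
  ultimately have "\<alpha> * g q - z \<bullet> d \<le> \<alpha> * g (q + d)"
    by (simp add: dual_pairing_def inner_add_left inner_add_right inner_diff_right inner_commute
        algebra_simps)
  then show "g q + - (z /\<^sub>R \<alpha>) \<bullet> d \<le> g (q + d)"
    using \<alpha>_pos by (simp add: field_simps)
qed

end

text \<open>Adding the variational inequalities for the two measures bounds the distance of two dual minimizers by the
  difference of the tilted means at the same point; the difference of the tilted means of \<open>M\<close> at
  the two points drops out by monotonicity.\<close>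

lemma (in smooth_mem_problem) dual_minimizers_close:
  assumes M: "bounded_vector_measure M r" and N: "bounded_vector_measure N r'"
    and z: "dual_minimizer M z" and w: "dual_minimizer N w"
  shows "norm (z - w) \<le> \<alpha> / \<beta> * op_norm A
           * norm (tilted_mean M (transpose A *v w) - tilted_mean N (transpose A *v w))"
proof -
  interpret M: mem_problem_measure g A b \<alpha> \<beta> M r
    using M by (intro mem_problem_measure.intro smooth_mem_problem_axioms)
  interpret N: mem_problem_measure g A b \<alpha> \<beta> N r'
    using N by (intro mem_problem_measure.intro smooth_mem_problem_axioms)
  let ?y = "transpose A *v z" and ?y' = "transpose A *v w"
  let ?e = "tilted_mean M ?y' - tilted_mean N ?y'"
  have dom: "z \<in> dual_domain" "w \<in> dual_domain" using z w by (auto simp: dual_minimizer_def)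
  have y: "?y - ?y' = transpose A *v (z - w)"
    by (simp add: matrix_vector_mult_diff_distrib)
  have mono: "0 \<le> (tilted_mean M ?y - tilted_mean M ?y') \<bullet> (?y - ?y')"
    using M.log_mgf_tangent[of ?y "?y' - ?y"] M.log_mgf_tangent[of ?y' "?y - ?y'"]
    by (simp add: inner_diff_left inner_diff_right)
  have "\<beta> / \<alpha> * (norm (z - w))\<^sup>2
      \<le> - ((A *v tilted_mean M ?y - A *v tilted_mean N ?y') \<bullet> (z - w))"
    using M.dual_minimizer_variational[OF z dom(2)] N.dual_minimizer_variational[OF w dom(1)]
    by (simp add: norm_minus_commute inner_diff_left inner_diff_right field_simps)
  also have "\<dots> = - ((tilted_mean M ?y - tilted_mean M ?y') \<bullet> (?y - ?y')) - ?e \<bullet> (?y - ?y')"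
    unfolding y inner_transpose by (simp add: inner_diff_left matrix_vector_mult_diff_distrib)
  also have "\<dots> \<le> norm ?e * norm (?y - ?y')"
    using mono Cauchy_Schwarz_ineq2[of ?e "?y - ?y'"] by linarith
  also have "\<dots> \<le> norm ?e * (op_norm A * norm (z - w))"
    unfolding y by (intro mult_left_mono norm_transpose_vector_le) simp
  finally have *: "norm (z - w) * norm (z - w)
      \<le> norm (z - w) * (\<alpha> / \<beta> * op_norm A * norm ?e)"
    using \<alpha>_pos \<beta>_pos by (simp add: field_simps power2_eq_square)
  show ?thesis
  proof (cases "z = w")
    case False
    then show ?thesis using * by (subst (asm) mult_le_cancel_left_pos) auto
  qed (use \<alpha>_pos \<beta>_pos op_norm_nonneg[of A] in simp)
qed

text \<open>Strong convexity makes \<open>grad g\<close> expansive, and by the optimality condition its values at the two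
  primal candidates are \<open>- z / \<alpha>\<close> and \<open>- w / \<alpha>\<close>.\<close>

lemma (in smooth_mem_problem) tilted_means_close_of_strongly_convex:
  assumes M: "bounded_vector_measure M r" and N: "bounded_vector_measure N r'"
    and z: "dual_minimizer M z" and w: "dual_minimizer N w"
    and "\<gamma> > 0" "inj (\<lambda>v. A *v v)" "strongly_convex (1 / \<gamma>) g"
  shows "norm (tilted_mean M (transpose A *v z) - tilted_mean N (transpose A *v w))
           \<le> \<gamma> / (\<alpha> * sigma_min A) * norm (z - w)"
proof -
  interpret M: mem_problem_measure g A b \<alpha> \<beta> M r
    using M by (intro mem_problem_measure.intro smooth_mem_problem_axioms)
  interpret N: mem_problem_measure g A b \<alpha> \<beta> N r'
    using N by (intro mem_problem_measure.intro smooth_mem_problem_axioms)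
  let ?p = "tilted_mean M (transpose A *v z)" and ?q = "tilted_mean N (transpose A *v w)"
  have expansive: "norm (x - y) \<le> \<gamma> * norm (grad g x - grad g y)" for x y
    using strongly_convex_imp_gradient_expansive[OF assms(7) GDERIV_g GDERIV_g, of x y] \<open>\<gamma> > 0\<close>
    by (simp add: field_simps)
  have "sigma_min A * norm (?p - ?q) \<le> norm (A *v (?p - ?q))"
    by (rule sigma_min_bound(2)[OF assms(6)])
  also have "\<dots> = norm ((A *v ?p - b) - (A *v ?q - b))"
    by (simp add: matrix_vector_mult_diff_distrib)
  also have "\<dots> \<le> \<gamma> * norm (grad g (A *v ?p - b) - grad g (A *v ?q - b))"
    by (rule expansive)
  also have "grad g (A *v ?p - b) - grad g (A *v ?q - b) = - ((z - w) /\<^sub>R \<alpha>)"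
    unfolding M.dual_minimizer_eq_grad[OF z, symmetric] N.dual_minimizer_eq_grad[OF w, symmetric]
    by (simp add: scaleR_diff_right)
  also have "\<gamma> * norm (- ((z - w) /\<^sub>R \<alpha>)) = \<gamma> / \<alpha> * norm (z - w)"
    using \<alpha>_pos by (simp add: divide_inverse)
  finally show ?thesis
    using sigma_min_bound(1)[OF assms(6)] \<alpha>_pos by (simp add: field_simps)
qed

section \<open>Relative entropy and the primal problem\<close>

lemma log_exp_one: "log (exp 1) x = ln x"
  by (simp add: log_def)

context bounded_vector_measure
begin

lemma bounded_vector_measure_absolutely_continuous:
  assumes "prob_space Q" "sets Q = sets M" "absolutely_continuous M Q"
  shows "bounded_vector_measure Q r"
proof -
  interpret Q: prob_space Q by fact
  show ?thesis
  proof
    show "(\<lambda>u. u) \<in> borel_measurable Q"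
      using ident_measurable assms(2) measurable_cong_sets by blast
    show "AE u in Q. norm u \<le> r"
      using assms(2,3) AE_norm_le by (intro absolutely_continuous_AE[of Q M]) auto
  qed
qed

text \<open>The variational lower bound for the relative entropy: the difference of the two sides is
  the relative entropy with respect to the tilted measure, which is nonnegative.\<close>

lemma KL_divergence_ge:
  assumes Q: "prob_space Q" "sets Q = sets M" "absolutely_continuous M Q"
    and int: "integrable Q (entropy_density (exp 1) M Q)"
  shows "y \<bullet> (\<integral>u. u \<partial>Q) - log_mgf M y \<le> KL_divergence (exp 1) M Q"
proof -
  interpret Q: bounded_vector_measure Q r
    by (rule bounded_vector_measure_absolutely_continuous[OF Q])
  have "finite_measure Q" by unfold_locales
  from real_RN_deriv[OF this Q(3,2)] obtain D where D [measurable]: "D \<in> borel_measurable M"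
    and D_RN: "AE u in M. RN_deriv M Q u = ennreal (D u)" and D_nonneg: "\<And>u. 0 \<le> D u"
    by blast
  have Q_eq: "Q = density M D"
  proof -
    have "Q = density M (RN_deriv M Q)" using density_RN_deriv[OF Q(3,2)] by simp
    also have "\<dots> = density M D" using D_RN by (intro density_cong) auto
    finally show ?thesis .
  qed
  define f where "f u = exp (y \<bullet> u - log_mgf M y)" for u
  have f [measurable]: "f \<in> borel_measurable M" unfolding f_def by measurable
  have ent: "AE u in M. entropy_density (exp 1) M Q u = ln (D u)"
    using D_RN by eventually_elim (simp add: entropy_density_def log_exp_one D_nonneg)
  have ent': "AE u in Q. entropy_density (exp 1) M Q u = ln (D u)"
    using Q(2,3) ent by (intro absolutely_continuous_AE[of Q M]) auto
  have entm: "entropy_density (exp 1) M Q \<in> borel_measurable Q"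
    using measurable_entropy_density measurable_cong_sets[OF Q(2)] by blast
  have lnm: "(\<lambda>u. ln (D u)) \<in> borel_measurable Q"
    unfolding measurable_cong_sets[OF Q(2) refl] by measurable
  have int_ln: "integrable Q (\<lambda>u. ln (D u))"
    using int integrable_cong_AE[OF entm lnm ent'] by simp
  then have int_diff: "integrable Q (\<lambda>u. ln (D u) - (y \<bullet> u - log_mgf M y))"
    by simp
  have D_ln: "D u * log (exp 1) (D u / f u) = D u * (ln (D u) - (y \<bullet> u - log_mgf M y))" for u
    using D_nonneg[of u] by (cases "D u = 0") (auto simp: log_exp_one f_def ln_div)
  have "0 \<le> KL_divergence (exp 1) (density M f) (density M D)"
  proof (rule KL_density_density_nonneg)
    show "prob_space (density M f)"
      using prob_space_tilted[of y] by (simp add: tilted_def f_def)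
    show "prob_space (density M D)" using Q(1) Q_eq by simp
    show "integrable M (\<lambda>u. D u * log (exp 1) (D u / f u))"
      unfolding D_ln using int_diff unfolding Q_eq
      by (subst (asm) integrable_real_density) (auto simp: D_nonneg)
  qed (auto simp: D_nonneg f_def)
  also have "\<dots> = (\<integral>u. D u * log (exp 1) (D u / f u) \<partial>M)"
    by (rule KL_density_density) (auto simp: D_nonneg f_def)
  also have "\<dots> = (\<integral>u. ln (D u) - (y \<bullet> u - log_mgf M y) \<partial>Q)"
    unfolding D_ln unfolding Q_eq by (subst integral_real_density) (auto simp: D_nonneg)
  also have "\<dots> = (\<integral>u. ln (D u) \<partial>Q) - (y \<bullet> (\<integral>u. u \<partial>Q) - log_mgf M y)"
    using int_ln by (simp add: Q.integral_inner_mean Q.prob_space)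
  also have "(\<integral>u. ln (D u) \<partial>Q) = KL_divergence (exp 1) M Q"
    unfolding KL_divergence_def by (rule integral_cong_AE[OF entm lnm ent', symmetric])
  finally show ?thesis by simp
qed

text \<open>The logarithm of the density of the tilted measure is affine, so the variational lower bound is
  attained.\<close>

lemma KL_tilted: "KL (tilted M y) M = ereal (y \<bullet> tilted_mean M y - log_mgf M y)"
proof -
  interpret T: bounded_vector_measure "tilted M y" r by (rule bounded_vector_measure_tilted)
  let ?f = "\<lambda>u. exp (y \<bullet> u - log_mgf M y)"
  have ac: "absolutely_continuous M (tilted M y)"
    unfolding tilted_def by (rule absolutely_continuousI_density) simp
  have "AE u in M. ennreal (?f u) = RN_deriv M (tilted M y) u"
    by (rule RN_deriv_unique) (auto simp: tilted_def)
  then have ent: "AE u in M. entropy_density (exp 1) M (tilted M y) u = y \<bullet> u - log_mgf M y"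
  proof eventually_elim
    case (elim u)
    then show ?case by (simp add: entropy_density_def log_exp_one flip: elim)
  qed
  have ent': "AE u in tilted M y. entropy_density (exp 1) M (tilted M y) u = y \<bullet> u - log_mgf M y"
    using ac ent by (intro absolutely_continuous_AE[of "tilted M y" M]) auto
  have entm: "entropy_density (exp 1) M (tilted M y) \<in> borel_measurable (tilted M y)"
    unfolding measurable_cong_sets[OF sets_tilted refl] by (rule measurable_entropy_density)
  have linm: "(\<lambda>u. y \<bullet> u - log_mgf M y) \<in> borel_measurable (tilted M y)"
    by simp
  have "integrable (tilted M y) (entropy_density (exp 1) M (tilted M y))"
    using integrable_cong_AE[OF entm linm ent'] by simp
  moreover have "KL_divergence (exp 1) M (tilted M y) = (\<integral>u. y \<bullet> u - log_mgf M y \<partial>tilted M y)"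
    unfolding KL_divergence_def by (rule integral_cong_AE[OF entm linm ent'])
  then have "KL_divergence (exp 1) M (tilted M y) = y \<bullet> tilted_mean M y - log_mgf M y"
    by (simp add: T.integral_inner_mean T.prob_space[simplified] tilted_mean_def)
  ultimately show ?thesis using ac by (simp add: KL_def)
qed

lemma mem_fun_ge:
  assumes "M \<in> prob_measures \<X>"
  shows "ereal (y \<bullet> x - log_mgf M y) \<le> mem_fun \<X> M x"
  unfolding mem_fun_def
proof (rule INF_greatest)
  fix Q assume "Q \<in> {Q \<in> prob_measures \<X>. (\<integral>u. u \<partial>Q) = x}"
  then have Q: "prob_space Q" "sets Q = sets M" "(\<integral>u. u \<partial>Q) = x"
    using assms by (auto simp: prob_measures_def)
  then show "ereal (y \<bullet> x - log_mgf M y) \<le> KL Q M"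
    using KL_divergence_ge[OF Q(1,2)] by (auto simp: KL_def)
qed

lemma mem_fun_tilted_mean_le:
  assumes "M \<in> prob_measures \<X>"
  shows "mem_fun \<X> M (tilted_mean M y) \<le> ereal (y \<bullet> tilted_mean M y - log_mgf M y)"
proof -
  have "mem_fun \<X> M (tilted_mean M y) \<le> KL (tilted M y) M"
    unfolding mem_fun_def
    using assms prob_space_tilted[of y]
    by (intro INF_lower) (auto simp: prob_measures_def tilted_mean_def)
  then show ?thesis by (simp add: KL_tilted)
qed

end

text \<open>Every competitor \<open>x\<close> is compared with the tilted mean \<open>p\<close>. The tangent of \<open>g\<close> at \<open>A *v p - b\<close>,
  whose slope is \<open>- z / \<alpha>\<close>, bounds the first term of the primal objective, and the entropy bound at
  the perturbed point \<open>y + s *\<^sub>R (x - p)\<close> bounds the second. The perturbation gains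
  \<open>s * (norm (x - p))\<^sup>2\<close> up to second order in \<open>s\<close>, so no other point is optimal.\<close>

lemma (in mem_problem_measure) primal_solution_eq_tilted_mean:
  assumes M: "M \<in> prob_measures \<X>" and z: "dual_minimizer M z"
    and x: "primal_solution \<X> g A b \<alpha> M x"
  shows "x = tilted_mean M (transpose A *v z)"
proof -
  define y where "y = transpose A *v z"
  define p where "p = tilted_mean M y"
  define N where "N = (norm (x - p))\<^sup>2"
  have obj: "primal_obj \<X> g A b \<alpha> M x \<le> ereal (\<alpha> * g (A *v p - b) + (y \<bullet> p - log_mgf M y))"
  proof -
    have "primal_obj \<X> g A b \<alpha> M x \<le> primal_obj \<X> g A b \<alpha> M p"
      using x unfolding primal_solution_def is_arg_min_def by (auto simp: not_less)
    also have "\<dots> \<le> ereal (\<alpha> * g (A *v p - b)) + ereal (y \<bullet> p - log_mgf M y)"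
      unfolding primal_obj_def p_def by (intro add_left_mono mem_fun_tilted_mean_le M)
    finally show ?thesis by simp
  qed
  have g_ge: "\<alpha> * g (A *v p - b) - y \<bullet> (x - p) \<le> \<alpha> * g (A *v x - b)"
  proof -
    have "g (A *v p - b) + - (z /\<^sub>R \<alpha>) \<bullet> (A *v (x - p)) \<le> g (A *v p - b + A *v (x - p))"
      using g_tangent[of "A *v p - b" "A *v (x - p)"] dual_minimizer_eq_grad[OF z]
      by (simp add: p_def y_def)
    also have "A *v p - b + A *v (x - p) = A *v x - b"
      by (simp add: matrix_vector_mult_diff_distrib)
    finally have "\<alpha> * (g (A *v p - b) + - (z /\<^sub>R \<alpha>) \<bullet> (A *v (x - p))) \<le> \<alpha> * g (A *v x - b)"
      using \<alpha>_pos by simp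
    moreover have "z \<bullet> (A *v (x - p)) = y \<bullet> (x - p)"
      using inner_transpose[of "x - p" A z] by (simp add: y_def inner_commute)
    moreover have "\<alpha> * (g (A *v p - b) + - (z /\<^sub>R \<alpha>) \<bullet> (A *v (x - p)))
        = \<alpha> * g (A *v p - b) - z \<bullet> (A *v (x - p))"
      using \<alpha>_pos by (simp add: right_diff_distrib)
    ultimately show ?thesis by simp
  qed
  have "N \<le> 0"
  proof (rule le_of_le_add_small_multiple)
    fix s :: real assume s: "0 < s" "s < 1"
    define y' where "y' = y + s *\<^sub>R (x - p)"
    have "ereal (\<alpha> * g (A *v x - b) + (y' \<bullet> x - log_mgf M y')) \<le> primal_obj \<X> g A b \<alpha> M x"
      unfolding primal_obj_def plus_ereal.simps(1)[symmetric]
      by (intro add_left_mono mem_fun_ge M)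
    also note obj
    finally have "\<alpha> * g (A *v x - b) + (y' \<bullet> x - log_mgf M y')
        \<le> \<alpha> * g (A *v p - b) + (y \<bullet> p - log_mgf M y)"
      by simp
    moreover have "log_mgf M y' \<le> log_mgf M y + p \<bullet> (s *\<^sub>R (x - p)) + r\<^sup>2 / 2 * (s\<^sup>2 * N)"
      using log_mgf_quadratic_upper[of y "s *\<^sub>R (x - p)"]
      by (simp add: y'_def p_def N_def power_mult_distrib)
    ultimately have "s * N \<le> s * (s * (r\<^sup>2 / 2 * N))"
      using g_ge unfolding y'_def N_def power2_norm_eq_inner
      by (simp add: inner_add_left inner_diff_left inner_diff_right inner_commute
          power2_eq_square algebra_simps)
    then show "N \<le> 0 + s * (r\<^sup>2 / 2 * N)" using s by simp
  qed
  then show ?thesis by (simp add: N_def p_def y_def)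
qed

section \<open>Supports and empirical measures\<close>

text \<open>The complement of the support is covered by those members of a countable basis that are null
  sets.\<close>

lemma AE_in_msupp:
  fixes M :: "'a::second_countable_topology measure"
  assumes "sets M = sets (borel_on S)"
  shows "AE x in M. x \<in> msupp M"
proof -
  obtain B :: "'a set set" where B: "countable B" "topological_basis B"
    using ex_countable_basis by blast
  have "AE x in M. \<forall>U\<in>{U\<in>B. emeasure M (U \<inter> space M) = 0}. x \<notin> U"
  proof (rule AE_ball_countable')
    show "countable {U\<in>B. emeasure M (U \<inter> space M) = 0}" using B(1) by simp
    fix U assume U: "U \<in> {U\<in>B. emeasure M (U \<inter> space M) = 0}"
    then have "open U" using B(2) topological_basis_open by blast
    then have "U \<inter> space M \<in> sets M"
      unfolding assms sets_eq_imp_space_eq[OF assms]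
      by (auto simp: sets_restrict_space space_restrict_space image_iff intro!: bexI[of _ U])
    with U show "AE x in M. x \<notin> U"
      by (intro AE_I[of _ _ "U \<inter> space M"]) auto
  qed
  then show ?thesis
  proof (rule AE_mp, intro AE_I2 impI)
    fix x assume x: "x \<in> space M" and *: "\<forall>U\<in>{U\<in>B. emeasure M (U \<inter> space M) = 0}. x \<notin> U"
    show "x \<in> msupp M"
      unfolding msupp_def
    proof (intro CollectI conjI allI impI x)
      fix U :: "'a set" assume U: "open U \<and> x \<in> U"
      then obtain V where V: "V \<in> B" "x \<in> V" "V \<subseteq> U"
        using B(2) topological_basisE by metis
      have "U \<inter> space M \<in> sets M"
        using U unfolding assms sets_eq_imp_space_eq[OF assms]
        by (auto simp: sets_restrict_space space_restrict_space image_iff intro!: bexI[of _ U])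
      then have "emeasure M (V \<inter> space M) \<le> emeasure M (U \<inter> space M)"
        using V by (intro emeasure_mono) auto
      moreover have "emeasure M (V \<inter> space M) \<noteq> 0" using * V by blast
      ultimately show "emeasure M (U \<inter> space M) > 0"
        by (metis le_zero_eq not_gr_zero)
    qed
  qed
qed

lemma bounded_vector_measure_msupp:
  fixes M :: "(real^'m) measure"
  assumes "bounded S" "M \<in> prob_measures S"
  shows "bounded_vector_measure M (sup_norm (msupp M))"
proof -
  have M: "prob_space M" "sets M = sets (borel_on S)"
    using assms(2) by (auto simp: prob_measures_def)
  interpret prob_space M by fact
  have "msupp M \<subseteq> S"
    using sets_eq_imp_space_eq[OF M(2)] by (auto simp: msupp_def space_restrict_space)
  then have "bdd_above (norm ` msupp M)"
    using assms(1) by (meson bdd_above_norm bounded_subset)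
  then have "norm u \<le> sup_norm (msupp M)" if "u \<in> msupp M" for u
    unfolding sup_norm_def using that by (rule cSUP_upper[rotated])
  then have "AE u in M. norm u \<le> sup_norm (msupp M)"
    using AE_in_msupp[OF M(2)] by (auto elim: eventually_mono)
  moreover have "(\<lambda>u. u) \<in> borel_measurable M"
    unfolding measurable_cong_sets[OF M(2) refl] by (rule measurable_restrict_space1) simp
  ultimately show ?thesis by unfold_locales
qed

lemma measurable_uniform_count_measure:
  "s ` A \<subseteq> space N \<Longrightarrow> s \<in> measurable (uniform_count_measure A) N"
  by (auto simp: measurable_def space_uniform_count_measure sets_uniform_count_measure)

lemma integral_empirical:
  fixes f :: "'a \<Rightarrow> 'b::{banach, second_countable_topology}"
  assumes "s ` {..<n} \<subseteq> space N" and [measurable]: "f \<in> borel_measurable N"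
  shows "(\<integral>u. f u \<partial>empirical N n s) = (\<Sum>i<n. f (s i)) /\<^sub>R n"
proof -
  have "(\<integral>u. f u \<partial>empirical N n s) = (\<integral>i. f (s i) \<partial>uniform_count_measure {..<n})"
    unfolding empirical_def using assms
    by (intro integral_distr measurable_uniform_count_measure)
  also have "\<dots> = (\<Sum>i<n. (1 / n) *\<^sub>R f (s i))"
    unfolding uniform_count_measure_def by (subst lebesgue_integral_point_measure_finite) auto
  also have "\<dots> = (\<Sum>i<n. f (s i)) /\<^sub>R n"
    by (simp add: scaleR_sum_right inverse_eq_divide)
  finally show ?thesis .
qed

lemma bounded_vector_measure_empirical:
  fixes S :: "(real^'m) set"
  assumes "n \<ge> 1" "s ` {..<n} \<subseteq> S" "\<And>i. i < n \<Longrightarrow> norm (s i) \<le> r"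
  shows "bounded_vector_measure (empirical (borel_on S) n s) r"
proof -
  have s: "s \<in> measurable (uniform_count_measure {..<n}) (borel_on S)"
    using assms(2) by (intro measurable_uniform_count_measure) (simp add: space_restrict_space)
  have ident: "(\<lambda>u. u) \<in> borel_measurable (borel_on S)"
    by (rule measurable_restrict_space1) simp
  have "0 \<in> {..<n}" using assms(1) by simp
  then interpret U: prob_space "uniform_count_measure {..<n}"
    by (intro prob_space_uniform_count_measure) blast+
  interpret prob_space "empirical (borel_on S) n s"
    unfolding empirical_def by (rule U.prob_space_distr[OF s])
  have "(\<lambda>u. u) \<in> borel_measurable (empirical (borel_on S) n s)"
    unfolding empirical_def measurable_distr_eq1 by (rule ident)
  moreover have "AE u in empirical (borel_on S) n s. norm u \<le> r"
    unfolding empirical_def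
  proof (subst AE_distr_iff[OF s])
    show "{u \<in> space (borel_on S). norm u \<le> r} \<in> sets (borel_on S)"
      by (rule borel_measurable_le[OF measurable_compose[OF ident borel_measurable_norm] borel_measurable_const])
    show "AE i in uniform_count_measure {..<n}. norm (s i) \<le> r"
      using assms(3) by (intro AE_I2) (simp add: space_uniform_count_measure)
  qed
  ultimately show ?thesis by unfold_locales
qed

section \<open>Sums of independent centered vectors\<close>

text \<open>The second moment of a sum of independent centered vectors is the sum of the second moments,
  because the mixed terms vanish; the first moment is at most the square root of the second.\<close>

lemma (in prob_space) expectation_norm_sum_indep_le:
  fixes Y :: "'i \<Rightarrow> 'a \<Rightarrow> 'b::euclidean_space"
  assumes indep: "indep_vars (\<lambda>_. borel) Y I" and "finite I"
    and bound: "\<And>i. i \<in> I \<Longrightarrow> AE \<omega> in M. norm (Y i \<omega>) \<le> B" and "0 \<le> B"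
    and centered: "\<And>i. i \<in> I \<Longrightarrow> expectation (Y i) = 0"
  shows "integrable M (\<lambda>\<omega>. norm (\<Sum>i\<in>I. Y i \<omega>))"
    and "expectation (\<lambda>\<omega>. norm (\<Sum>i\<in>I. Y i \<omega>)) \<le> sqrt (card I) * B"
proof -
  define S where "S \<omega> = (\<Sum>i\<in>I. Y i \<omega>)" for \<omega>
  have Y [measurable]: "Y i \<in> borel_measurable M" if "i \<in> I" for i
    using indep that unfolding indep_vars_def by auto
  have Y_int: "integrable M (Y i)" if "i \<in> I" for i
    using bound[OF that] Y[OF that] by (rule integrable_const_bound)
  have inner_int: "integrable M (\<lambda>\<omega>. Y i \<omega> \<bullet> Y j \<omega>)" if "i \<in> I" "j \<in> I" for i j
  proof (rule integrable_const_bound[where B = "B * B"])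
    show "AE \<omega> in M. norm (Y i \<omega> \<bullet> Y j \<omega>) \<le> B * B"
      using bound[OF that(1)] bound[OF that(2)]
    proof eventually_elim
      case (elim \<omega>)
      have "norm (Y i \<omega> \<bullet> Y j \<omega>) \<le> norm (Y i \<omega>) * norm (Y j \<omega>)"
        using Cauchy_Schwarz_ineq2 by simp
      also have "\<dots> \<le> B * B" using elim \<open>0 \<le> B\<close> by (intro mult_mono) auto
      finally show ?case .
    qed
  qed (use Y that in measurable)
  have mixed: "expectation (\<lambda>\<omega>. Y i \<omega> \<bullet> Y j \<omega>) = 0" if ij: "i \<in> I" "j \<in> I" "i \<noteq> j" for i j
  proof -
    have comp: "expectation (\<lambda>\<omega>. (Y i \<omega> \<bullet> e) * (Y j \<omega> \<bullet> e)) = 0"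
      and comp_int: "integrable M (\<lambda>\<omega>. (Y i \<omega> \<bullet> e) * (Y j \<omega> \<bullet> e))" for e
    proof -
      have "indep_vars (\<lambda>_. borel) Y {i, j}"
        using indep ij by (intro indep_vars_subset[OF indep]) auto
      then have ind: "indep_vars (\<lambda>_. borel) (\<lambda>k \<omega>. Y k \<omega> \<bullet> e) {i, j}"
        by (rule indep_vars_compose2) measurable
      have int: "integrable M (\<lambda>\<omega>. Y k \<omega> \<bullet> e)" if "k \<in> {i, j}" for k
        using Y_int that ij by (intro integrable_inner_left) auto
      have "expectation (\<lambda>\<omega>. \<Prod>k\<in>{i, j}. Y k \<omega> \<bullet> e) = (\<Prod>k\<in>{i, j}. expectation (\<lambda>\<omega>. Y k \<omega> \<bullet> e))"
        using ind int by (intro indep_vars_lebesgue_integral) auto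
      also have "\<dots> = expectation (Y i) \<bullet> e * (expectation (Y j) \<bullet> e)"
        using ij Y_int by (simp add: integral_inner_left)
      finally show "expectation (\<lambda>\<omega>. (Y i \<omega> \<bullet> e) * (Y j \<omega> \<bullet> e)) = 0"
        using ij centered by simp
      have "integrable M (\<lambda>\<omega>. \<Prod>k\<in>{i, j}. Y k \<omega> \<bullet> e)"
        using ind int by (intro indep_vars_integrable) auto
      then show "integrable M (\<lambda>\<omega>. (Y i \<omega> \<bullet> e) * (Y j \<omega> \<bullet> e))"
        using ij by simp
    qed
    have "expectation (\<lambda>\<omega>. Y i \<omega> \<bullet> Y j \<omega>)
        = expectation (\<lambda>\<omega>. \<Sum>e\<in>Basis. (Y i \<omega> \<bullet> e) * (Y j \<omega> \<bullet> e))"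
      by (intro Bochner_Integration.integral_cong refl euclidean_inner)
    also have "\<dots> = (\<Sum>e\<in>Basis. expectation (\<lambda>\<omega>. (Y i \<omega> \<bullet> e) * (Y j \<omega> \<bullet> e)))"
      by (rule Bochner_Integration.integral_sum) (rule comp_int)
    also have "\<dots> = 0" using comp by simp
    finally show ?thesis .
  qed
  have S_sq: "(norm (S \<omega>))\<^sup>2 = (\<Sum>i\<in>I. \<Sum>j\<in>I. Y i \<omega> \<bullet> Y j \<omega>)" for \<omega>
    unfolding power2_norm_eq_inner S_def by (simp add: inner_sum_left inner_sum_right) (rule sum.swap)
  have S_sq_int: "integrable M (\<lambda>\<omega>. (norm (S \<omega>))\<^sup>2)"
    unfolding S_sq using inner_int by (intro Bochner_Integration.integrable_sum)
  show S_int: "integrable M (\<lambda>\<omega>. norm (\<Sum>i\<in>I. Y i \<omega>))"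
    using Y_int by (intro integrable_norm Bochner_Integration.integrable_sum)
  have "expectation (\<lambda>\<omega>. (norm (S \<omega>))\<^sup>2) = (\<Sum>i\<in>I. \<Sum>j\<in>I. expectation (\<lambda>\<omega>. Y i \<omega> \<bullet> Y j \<omega>))"
    unfolding S_sq using inner_int
    by (simp add: Bochner_Integration.integral_sum Bochner_Integration.integrable_sum)
  also have "\<dots> = (\<Sum>i\<in>I. expectation (\<lambda>\<omega>. Y i \<omega> \<bullet> Y i \<omega>))"
  proof (rule sum.cong[OF refl])
    fix i assume "i \<in> I"
    have "(\<Sum>j\<in>I. expectation (\<lambda>\<omega>. Y i \<omega> \<bullet> Y j \<omega>))
        = (\<Sum>j\<in>I. if j = i then expectation (\<lambda>\<omega>. Y i \<omega> \<bullet> Y i \<omega>) else 0)"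
      using mixed \<open>i \<in> I\<close> by (intro sum.cong) auto
    then show "(\<Sum>j\<in>I. expectation (\<lambda>\<omega>. Y i \<omega> \<bullet> Y j \<omega>)) = expectation (\<lambda>\<omega>. Y i \<omega> \<bullet> Y i \<omega>)"
      using \<open>finite I\<close> \<open>i \<in> I\<close> by simp
  qed
  also have "\<dots> \<le> (\<Sum>i\<in>I. B\<^sup>2)"
  proof (rule sum_mono)
    fix i assume i: "i \<in> I"
    have "expectation (\<lambda>\<omega>. Y i \<omega> \<bullet> Y i \<omega>) \<le> expectation (\<lambda>\<omega>. B\<^sup>2)"
    proof (rule integral_mono_AE)
      show "AE \<omega> in M. Y i \<omega> \<bullet> Y i \<omega> \<le> B\<^sup>2"
        using bound[OF i] by eventually_elim (simp add: power_mono flip: power2_norm_eq_inner)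
    qed (use inner_int i in auto)
    then show "expectation (\<lambda>\<omega>. Y i \<omega> \<bullet> Y i \<omega>) \<le> B\<^sup>2" by (simp add: prob_space)
  qed
  finally have "expectation (\<lambda>\<omega>. (norm (S \<omega>))\<^sup>2) \<le> card I * B\<^sup>2" by simp
  moreover have "(expectation (\<lambda>\<omega>. norm (S \<omega>)))\<^sup>2 \<le> expectation (\<lambda>\<omega>. (norm (S \<omega>))\<^sup>2)"
    using variance_positive[of "\<lambda>\<omega>. norm (S \<omega>)"] S_int S_sq_int
    by (subst (asm) variance_eq) (auto simp: S_def)
  ultimately have "(expectation (\<lambda>\<omega>. norm (S \<omega>)))\<^sup>2 \<le> (sqrt (card I) * B)\<^sup>2"
    by (simp add: power_mult_distrib)
  then show "expectation (\<lambda>\<omega>. norm (\<Sum>i\<in>I. Y i \<omega>)) \<le> sqrt (card I) * B"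
    unfolding S_def by (rule power2_le_imp_le) (use \<open>0 \<le> B\<close> in simp)
qed

section \<open>Concentration of the empirical tilted mean\<close>

lemma tilted_mean_empirical:
  fixes S :: "(real^'m) set"
  assumes "n \<ge> 1" "s ` {..<n} \<subseteq> S"
  shows "tilted_mean (empirical (borel_on S) n s) y
           = (\<Sum>i<n. exp (y \<bullet> s i) *\<^sub>R s i) /\<^sub>R (\<Sum>i<n. exp (y \<bullet> s i))"
proof -
  \<comment> \<open>The formula does not involve the radius, so a crude bound on the sample points suffices.\<close>
  interpret E: bounded_vector_measure "empirical (borel_on S) n s" "\<Sum>i<n. norm (s i)"
    using assms by (intro bounded_vector_measure_empirical) (auto intro: member_le_sum)
  have "s ` {..<n} \<subseteq> space (borel_on S)" using assms(2) by (simp add: space_restrict_space)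
  moreover have "(\<lambda>u. exp (y \<bullet> u) *\<^sub>R u) \<in> borel_measurable (borel_on S)"
    "(\<lambda>u. exp (y \<bullet> u)) \<in> borel_measurable (borel_on S)"
    by (auto intro!: measurable_restrict_space1)
  ultimately show ?thesis
    using assms(1) by (simp add: E.tilted_mean_eq_quotient integral_empirical)
qed

lemma (in prob_space) expectation_le_of_AE_affine:
  fixes f h :: "'a \<Rightarrow> real"
  assumes [measurable]: "f \<in> borel_measurable M" and "\<And>\<omega>. 0 \<le> f \<omega>" and [simp]: "integrable M h"
    and le: "AE \<omega> in M. f \<omega> \<le> c * h \<omega> + d"
  shows "integrable M f" "expectation f \<le> c * expectation h + d"
proof -
  show f: "integrable M f"
  proof (rule Bochner_Integration.integrable_bound)
    show "integrable M (\<lambda>\<omega>. c * h \<omega> + d)" by simp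
    show "AE \<omega> in M. norm (f \<omega>) \<le> norm (c * h \<omega> + d)"
      using le
    proof eventually_elim
      case (elim \<omega>)
      with assms(2)[of \<omega>] show ?case by simp
    qed
  qed simp
  have "expectation f \<le> expectation (\<lambda>\<omega>. c * h \<omega> + d)"
    using f le by (intro integral_mono_AE) auto
  then show "expectation f \<le> c * expectation h + d" by (simp add: prob_space)
qed

locale bounded_iid_sample = P: prob_space P + M: bounded_vector_measure M r
  for P :: "'w measure" and M :: "(real^'m) measure" and r +
  fixes S :: "(real^'m) set" and n :: nat and X :: "nat \<Rightarrow> 'w \<Rightarrow> real^'m"
  assumes n_pos: "n \<ge> 1"
    and indep: "P.indep_vars (\<lambda>_. borel_on S) X {..<n}"
    and distr: "\<And>i. i < n \<Longrightarrow> distr P (borel_on S) (X i) = M"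
begin

definition sample :: "'w \<Rightarrow> nat \<Rightarrow> real^'m" where
  "sample \<omega> = (\<lambda>i\<in>{..<n}. X i \<omega>)"

definition emp :: "'w \<Rightarrow> (real^'m) measure" where
  "emp \<omega> = empirical (borel_on S) n (sample \<omega>)"

lemma X_measurable: "i < n \<Longrightarrow> X i \<in> measurable P (borel_on S)"
  using indep unfolding P.indep_vars_def by auto

lemma X_borel_measurable [measurable]: "i < n \<Longrightarrow> X i \<in> borel_measurable P"
  using X_measurable by (auto simp: measurable_restrict_space2_iff)

lemma sample_measurable: "sample \<in> measurable P (PiM {..<n} (\<lambda>_. borel_on S))"
  unfolding sample_def by (intro measurable_restrict X_measurable) simp

lemma sample_image: "\<omega> \<in> space P \<Longrightarrow> sample \<omega> ` {..<n} \<subseteq> S"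
  using measurable_space[OF X_measurable] by (auto simp: sample_def space_restrict_space)

lemma AE_X_norm_le:
  assumes "i < n"
  shows "AE \<omega> in P. norm (X i \<omega>) \<le> r"
  using M.AE_norm_le unfolding distr[OF assms, symmetric]
  by (rule AE_distrD[OF X_measurable[OF assms]])

lemma AE_bounded_vector_measure_emp: "AE \<omega> in P. bounded_vector_measure (emp \<omega>) r"
proof -
  have "AE \<omega> in P. \<forall>i\<in>{..<n}. norm (X i \<omega>) \<le> r"
    by (rule AE_ball_countable') (auto intro: AE_X_norm_le)
  then show ?thesis
    using AE_space
  proof eventually_elim
    case (elim \<omega>)
    then show ?case
      unfolding emp_def by (intro bounded_vector_measure_empirical n_pos sample_image)
        (auto simp: sample_def)
  qed
qed

text \<open>The quotient formula holds at every outcome, whereas the bound \<open>r\<close> on the sample holds only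
  almost surely.\<close>

lemma tilted_mean_emp_measurable:
  assumes [measurable]: "v \<in> borel_measurable P"
  shows "(\<lambda>\<omega>. tilted_mean (emp \<omega>) (v \<omega>)) \<in> borel_measurable P"
proof -
  have "tilted_mean (emp \<omega>) (v \<omega>)
      = (\<Sum>i<n. exp (v \<omega> \<bullet> X i \<omega>) *\<^sub>R X i \<omega>) /\<^sub>R (\<Sum>i<n. exp (v \<omega> \<bullet> X i \<omega>))"
    if "\<omega> \<in> space P" for \<omega>
    using tilted_mean_empirical[OF n_pos sample_image[OF that], of "v \<omega>"]
    by (simp add: emp_def sample_def)
  moreover have "(\<lambda>\<omega>. (\<Sum>i<n. exp (v \<omega> \<bullet> X i \<omega>) *\<^sub>R X i \<omega>) /\<^sub>R (\<Sum>i<n. exp (v \<omega> \<bullet> X i \<omega>)))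
      \<in> borel_measurable P"
    by measurable
  ultimately show ?thesis by (simp cong: measurable_cong)
qed

text \<open>Multiplied by its denominator, the deviation of the empirical tilted mean from \<open>q\<close>, the
  tilted mean of \<open>M\<close>, is the average of the independent vectors \<open>exp (y \<bullet> X i) *\<^sub>R (X i - q)\<close>. These
  have mean zero by the definition of \<open>q\<close> and norm at most \<open>2 * r * exp (norm y * r)\<close>; the
  denominator is at least \<open>exp (- norm y * r)\<close>. This is where the rate \<open>1 / sqrt n\<close> comes from.\<close>

lemma expectation_tilted_mean_deviation_le:
  fixes y :: "real^'m"
  defines "\<delta> \<equiv> \<lambda>\<omega>. norm (tilted_mean (emp \<omega>) y - tilted_mean M y)"
  shows "integrable P \<delta>" "P.expectation \<delta> \<le> 2 * r * exp (2 * norm y * r) / sqrt n"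
proof -
  define q where "q = tilted_mean M y"
  define f where "f u = exp (y \<bullet> u) *\<^sub>R (u - q)" for u
  define Y where "Y i \<omega> = f (X i \<omega>)" for i \<omega>
  define B where "B = exp (norm y * r) * (2 * r)"
  have f_meas: "f \<in> borel_measurable (borel_on S)"
    unfolding f_def by (rule measurable_restrict_space1) measurable
  have Y_indep: "P.indep_vars (\<lambda>_. borel) Y {..<n}"
    unfolding Y_def by (rule P.indep_vars_compose2[OF indep]) (rule f_meas)
  have f_bound: "norm (f u) \<le> B" if "norm u \<le> r" for u
  proof -
    have "y \<bullet> u \<le> norm y * norm u" by (rule norm_cauchy_schwarz)
    also have "\<dots> \<le> norm y * r" using that by (intro mult_left_mono) auto
    finally have "exp (y \<bullet> u) \<le> exp (norm y * r)" by simp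
    moreover have "norm (u - q) \<le> 2 * r"
      using norm_triangle_ineq4[of u q] M.norm_tilted_mean_le[of y] that by (simp add: q_def)
    ultimately show ?thesis
      unfolding f_def B_def by (auto intro!: mult_mono)
  qed
  have Y_bound: "AE \<omega> in P. norm (Y i \<omega>) \<le> B" if "i \<in> {..<n}" for i
    using AE_X_norm_le[of i] that by (auto simp: Y_def elim: eventually_mono intro: f_bound)
  have B_nonneg: "0 \<le> B" using M.radius_nonneg by (simp add: B_def)
  have Y_centered: "P.expectation (Y i) = 0" if "i \<in> {..<n}" for i
  proof -
    have "P.expectation (Y i) = (\<integral>u. f u \<partial>M)"
      unfolding Y_def using that distr[of i] X_measurable[of i] f_meas
      by (metis integral_distr lessThan_iff)
    also have "\<dots> = 0"
      unfolding f_def M.integral_exp_inner_deviation by (simp add: q_def)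
    finally show ?thesis .
  qed
  note sum = P.expectation_norm_sum_indep_le[OF Y_indep finite_lessThan Y_bound B_nonneg Y_centered]
  have "(\<lambda>\<omega>. tilted_mean (emp \<omega>) y) \<in> borel_measurable P"
    by (rule tilted_mean_emp_measurable) simp
  then have \<delta>_meas: "\<delta> \<in> borel_measurable P" unfolding \<delta>_def by measurable
  have "AE \<omega> in P. \<delta> \<omega> \<le> exp (norm y * r) / n * norm (\<Sum>i<n. Y i \<omega>) + 0"
    using AE_bounded_vector_measure_emp AE_space
  proof eventually_elim
    case (elim \<omega>)
    interpret E: bounded_vector_measure "emp \<omega>" r by (rule elim)
    have "sample \<omega> ` {..<n} \<subseteq> space (borel_on S)"
      using sample_image[OF elim(2)] by (simp add: space_restrict_space)
    then have "(\<integral>u. f u \<partial>emp \<omega>) = (\<Sum>i<n. Y i \<omega>) /\<^sub>R n"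
      unfolding emp_def by (simp add: integral_empirical f_meas) (simp add: Y_def sample_def)
    then have eq: "(\<integral>u. exp (y \<bullet> u) \<partial>emp \<omega>) *\<^sub>R (tilted_mean (emp \<omega>) y - q) = (\<Sum>i<n. Y i \<omega>) /\<^sub>R n"
      unfolding f_def E.integral_exp_inner_deviation .
    have "exp (- (norm y * r)) * \<delta> \<omega> \<le> (\<integral>u. exp (y \<bullet> u) \<partial>emp \<omega>) * \<delta> \<omega>"
      unfolding \<delta>_def by (intro mult_right_mono E.mgf_ge) simp
    also have "\<dots> = norm ((\<integral>u. exp (y \<bullet> u) \<partial>emp \<omega>) *\<^sub>R (tilted_mean (emp \<omega>) y - q))"
      using E.mgf_pos[of y] by (simp add: \<delta>_def q_def)
    also have "\<dots> = norm (\<Sum>i<n. Y i \<omega>) / n"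
      unfolding eq by (simp add: divide_inverse)
    finally show ?case by (simp add: exp_minus field_simps)
  qed
  note \<delta> = P.expectation_le_of_AE_affine[OF \<delta>_meas _ sum(1) this]
  show "integrable P \<delta>" by (rule \<delta>(1)) (simp add: \<delta>_def)
  have "P.expectation \<delta> \<le> exp (norm y * r) / n * P.expectation (\<lambda>\<omega>. norm (\<Sum>i<n. Y i \<omega>)) + 0"
    by (rule \<delta>(2)) (simp add: \<delta>_def)
  also have "\<dots> \<le> exp (norm y * r) / n * (sqrt n * B) + 0"
    using sum(2) by (intro add_mono mult_left_mono) auto
  also have "\<dots> = exp (norm y * r) * exp (norm y * r) * (2 * r) * (sqrt n / n)"
    by (simp add: B_def)
  also have "exp (norm y * r) * exp (norm y * r) = exp (2 * norm y * r)"
    by (simp flip: exp_add)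
  also have "sqrt n / n = 1 / sqrt n"
    using n_pos by (simp add: field_simps)
  finally show "P.expectation \<delta> \<le> 2 * r * exp (2 * norm y * r) / sqrt n"
    by (simp add: mult_ac)
qed

end

section \<open>Sample complexity of the dual and primal solutions\<close>

context smooth_mem_problem
begin

lemma approx_dual_solution_deviation:
  assumes M: "bounded_vector_measure M r" and N: "bounded_vector_measure N r'"
    and w: "dual_minimizer N w" and z: "z \<in> approx_dual_solutions g A b \<alpha> M \<epsilon>"
  shows "norm (z - w) \<le> \<alpha> / \<beta> * op_norm A
             * norm (tilted_mean M (transpose A *v w) - tilted_mean N (transpose A *v w))
           + sqrt (2 * \<alpha> / \<beta> * \<epsilon>)"
proof -
  interpret M: mem_problem_measure g A b \<alpha> \<beta> M r
    using M by (intro mem_problem_measure.intro smooth_mem_problem_axioms)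
  obtain z' where z': "dual_minimizer M z'" using M.dual_minimizer_exists by blast
  have "norm (z - w) \<le> norm (z' - w) + norm (z - z')"
    using norm_triangle_ineq[of "z' - w" "z - z'"] by simp
  also have "norm (z - z') \<le> sqrt (2 * \<alpha> / \<beta> * \<epsilon>)"
    using approx_dual_solutionsD[OF z] z'
    by (intro M.approx_minimizer_close[OF z']) (auto simp: dual_minimizer_def)
  finally show ?thesis
    using dual_minimizers_close[OF M N z' w] by linarith
qed

lemma tilted_mean_deviation:
  assumes M: "bounded_vector_measure M r"
  shows "norm (tilted_mean M (transpose A *v z) - tilted_mean N (transpose A *v w))
           \<le> r\<^sup>2 * op_norm A * norm (z - w)
             + norm (tilted_mean M (transpose A *v w) - tilted_mean N (transpose A *v w))"
proof -
  interpret M: bounded_vector_measure M r by (rule M)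
  let ?y = "transpose A *v z" and ?y' = "transpose A *v w"
  have "norm (tilted_mean M ?y - tilted_mean M ?y') \<le> r\<^sup>2 * norm (transpose A *v (z - w))"
    using M.tilted_mean_lipschitz[of ?y ?y'] by (simp add: matrix_vector_mult_diff_distrib)
  also have "\<dots> \<le> r\<^sup>2 * (op_norm A * norm (z - w))"
    by (intro mult_left_mono norm_transpose_vector_le) simp
  finally show ?thesis
    using norm_triangle_ineq[of "tilted_mean M ?y - tilted_mean M ?y'"
        "tilted_mean M ?y' - tilted_mean N ?y'"]
    by (simp add: mult.assoc)
qed

text \<open>Here the sampling error passes through the exact minimizer \<open>z'\<close> of the same empirical problem: the
  optimality condition compares \<open>z'\<close> with \<open>w\<close>, and only the optimization error \<open>\<epsilon>\<close> between \<open>z\<close> and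
  \<open>z'\<close> is multiplied by the Lipschitz constant of the tilted mean.\<close>

lemma tilted_mean_deviation_strongly_convex:
  assumes M: "bounded_vector_measure M r" and N: "bounded_vector_measure N r'"
    and w: "dual_minimizer N w" and z: "z \<in> approx_dual_solutions g A b \<alpha> M \<epsilon>"
    and \<gamma>: "\<gamma> > 0" "inj (\<lambda>v. A *v v)" "strongly_convex (1 / \<gamma>) g"
  shows "norm (tilted_mean M (transpose A *v z) - tilted_mean N (transpose A *v w))
           \<le> \<gamma> / (\<alpha> * sigma_min A) * (\<alpha> / \<beta> * op_norm A)
               * norm (tilted_mean M (transpose A *v w) - tilted_mean N (transpose A *v w))
             + r\<^sup>2 * op_norm A * sqrt (2 * \<alpha> / \<beta> * \<epsilon>)"
proof -
  interpret M: mem_problem_measure g A b \<alpha> \<beta> M r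
    using M by (intro mem_problem_measure.intro smooth_mem_problem_axioms)
  obtain z' where z': "dual_minimizer M z'" using M.dual_minimizer_exists by blast
  let ?p = "tilted_mean M (transpose A *v z)" and ?p' = "tilted_mean M (transpose A *v z')"
    and ?q = "tilted_mean N (transpose A *v w)"
  have "norm (?p - ?p') \<le> r\<^sup>2 * op_norm A * norm (z - z')"
    using tilted_mean_deviation[OF M, of z M z'] by simp
  also have "\<dots> \<le> r\<^sup>2 * op_norm A * sqrt (2 * \<alpha> / \<beta> * \<epsilon>)"
  proof (rule mult_left_mono)
    show "norm (z - z') \<le> sqrt (2 * \<alpha> / \<beta> * \<epsilon>)"
      using approx_dual_solutionsD[OF z] z'
      by (intro M.approx_minimizer_close[OF z']) (auto simp: dual_minimizer_def)
  qed (simp add: op_norm_nonneg)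
  finally have 1: "norm (?p - ?p') \<le> r\<^sup>2 * op_norm A * sqrt (2 * \<alpha> / \<beta> * \<epsilon>)" .
  have "norm (?p' - ?q) \<le> \<gamma> / (\<alpha> * sigma_min A) * norm (z' - w)"
    by (rule tilted_means_close_of_strongly_convex[OF M N z' w \<gamma>])
  also have "\<dots> \<le> \<gamma> / (\<alpha> * sigma_min A) * (\<alpha> / \<beta> * op_norm A
      * norm (tilted_mean M (transpose A *v w) - tilted_mean N (transpose A *v w)))"
    using \<gamma> \<alpha>_pos sigma_min_bound(1)[OF \<gamma>(2)]
    by (intro mult_left_mono dual_minimizers_close[OF M N z' w]) simp
  finally have 2: "norm (?p' - ?q) \<le> \<dots>" .
  have "norm (?p - ?q) \<le> norm (?p - ?p') + norm (?p' - ?q)"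
    using norm_triangle_ineq[of "?p - ?p'" "?p' - ?q"] by simp
  with 1 2 show ?thesis
    unfolding mult.assoc[of "\<gamma> / (\<alpha> * sigma_min A)"] by linarith
qed

end

theorem theorem3p1:
  fixes \<X> :: "(real^'m) set" and A :: "real^'m^'d" and b :: "real^'d"
    and \<alpha> \<beta> \<epsilon> :: real and g :: "real^'d \<Rightarrow> real"
    and \<mu> :: "(real^'m) measure" and P :: "'w measure"
    and n :: nat and X :: "nat \<Rightarrow> 'w \<Rightarrow> real^'m"
    and zhat :: "(nat \<Rightarrow> real^'m) \<Rightarrow> real^'d" and z\<mu> :: "real^'d"
  assumes "compact \<X>" and "\<alpha> > 0" and "\<beta> > 0"
    and "convex_on UNIV g" and "\<And>y. g differentiable (at y)"
    and "(1 / \<beta>)-lipschitz_on UNIV (grad g)"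
    and "\<mu> \<in> prob_measures \<X>"
    and "prob_space P" and "n \<ge> 1"
    and "prob_space.indep_vars P (\<lambda>_. borel_on \<X>) X {..<n}"
    and "\<And>i. i < n \<Longrightarrow> distr P (borel_on \<X>) (X i) = \<mu>"
    and "\<epsilon> \<ge> 0"
    and "zhat \<in> borel_measurable (PiM {..<n} (\<lambda>_. borel_on \<X>))"
    and "\<And>s. s \<in> space (PiM {..<n} (\<lambda>_. borel_on \<X>)) \<Longrightarrow>
           zhat s \<in> approx_dual_solutions g A b \<alpha> (empirical (borel_on \<X>) n s) \<epsilon>"
    and "dual_solution g A b \<alpha> \<mu> z\<mu>"
  shows
    "let r = sup_norm (msupp \<mu>);
         C' = 2 * r * exp (2 * op_norm A * norm z\<mu> * r);
         C = \<alpha> / \<beta> * op_norm A * C';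
         K' = r\<^sup>2 * op_norm A;
         sample = (\<lambda>\<omega>. \<lambda>i\<in>{..<n}. X i \<omega>);
         z\<epsilon> = (\<lambda>\<omega>. zhat (sample \<omega>));
         x\<epsilon> = (\<lambda>\<omega>. grad (log_mgf (empirical (borel_on \<X>) n (sample \<omega>))) (transpose A *v z\<epsilon> \<omega>))
     in (integrable P (\<lambda>\<omega>. norm (z\<epsilon> \<omega> - z\<mu>)) \<and>
         (\<integral>\<omega>. norm (z\<epsilon> \<omega> - z\<mu>) \<partial>P) \<le> C / sqrt n + sqrt (2 * \<alpha> / \<beta> * \<epsilon>)) \<and>
        (\<forall>x\<mu>. primal_solution \<X> g A b \<alpha> \<mu> x\<mu> \<longrightarrow>
           integrable P (\<lambda>\<omega>. norm (x\<epsilon> \<omega> - x\<mu>)) \<and>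
           (\<integral>\<omega>. norm (x\<epsilon> \<omega> - x\<mu>) \<partial>P)
             \<le> (K' * C + C') / sqrt n + K' * sqrt (2 * \<alpha> / \<beta> * \<epsilon>) \<and>
           (\<forall>\<gamma>>0. inj (\<lambda>v. A *v v) \<and> strongly_convex (1 / \<gamma>) g \<longrightarrow>
              (\<integral>\<omega>. norm (x\<epsilon> \<omega> - x\<mu>) \<partial>P)
                \<le> \<gamma> * C / (\<alpha> * sigma_min A) * (1 / sqrt n) + K' * sqrt (2 * \<alpha> / \<beta> * \<epsilon>)))"
proof -
  define r where "r = sup_norm (msupp \<mu>)"
  define C' where "C' = 2 * r * exp (2 * op_norm A * norm z\<mu> * r)"
  define C where "C = \<alpha> / \<beta> * op_norm A * C'"
  define K' where "K' = r\<^sup>2 * op_norm A"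
  have bounded_\<mu>: "bounded_vector_measure \<mu> r"
    unfolding r_def using assms(1,7) by (intro bounded_vector_measure_msupp compact_imp_bounded)
  interpret smooth_mem_problem g A b \<alpha> \<beta>
    by (rule smooth_mem_problem.intro) fact+
  interpret \<mu>: mem_problem_measure g A b \<alpha> \<beta> \<mu> r
    by (intro mem_problem_measure.intro smooth_mem_problem_axioms bounded_\<mu>)
  interpret bounded_iid_sample P \<mu> r \<X> n X
    by (intro bounded_iid_sample.intro bounded_iid_sample_axioms.intro bounded_\<mu>) fact+
  define z\<epsilon> where "z\<epsilon> \<omega> = zhat (sample \<omega>)" for \<omega>
  define x\<epsilon> where "x\<epsilon> \<omega> = grad (log_mgf (emp \<omega>)) (transpose A *v z\<epsilon> \<omega>)" for \<omega>
  define y where "y = transpose A *v z\<mu>"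
  define \<delta> where "\<delta> \<omega> = norm (tilted_mean (emp \<omega>) y - tilted_mean \<mu> y)" for \<omega>
  define e where "e = sqrt (2 * \<alpha> / \<beta> * \<epsilon>)"
  define a where "a = \<alpha> / \<beta> * op_norm A"
  have z\<mu>: "dual_minimizer \<mu> z\<mu>" by (rule dual_solution_imp_minimizer) fact
  have nonneg: "0 \<le> r" "0 \<le> a" "0 \<le> K'"
    using \<mu>.radius_nonneg op_norm_nonneg[of A] \<alpha>_pos \<beta>_pos by (auto simp: a_def K'_def)

  have \<delta>_int: "integrable P \<delta>"
    unfolding \<delta>_def by (rule expectation_tilted_mean_deviation_le(1))
  have \<delta>_le: "P.expectation \<delta> \<le> C' / sqrt n"
  proof -
    have "P.expectation \<delta> \<le> 2 * r * exp (2 * norm y * r) / sqrt n"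
      unfolding \<delta>_def by (rule expectation_tilted_mean_deviation_le(2))
    also have "\<dots> \<le> C' / sqrt n"
    proof -
      have "2 * norm y * r \<le> 2 * op_norm A * norm z\<mu> * r"
        using norm_transpose_vector_le[of A z\<mu>] nonneg by (simp add: y_def mult_right_mono)
      then show ?thesis
        unfolding C'_def using nonneg by (intro divide_right_mono mult_left_mono) auto
    qed
    finally show ?thesis .
  qed

  have z\<epsilon>_approx: "z\<epsilon> \<omega> \<in> approx_dual_solutions g A b \<alpha> (emp \<omega>) \<epsilon>" if "\<omega> \<in> space P" for \<omega>
    unfolding z\<epsilon>_def emp_def using measurable_space[OF sample_measurable that] by (rule assms(14))
  have z\<epsilon>_meas [measurable]: "z\<epsilon> \<in> borel_measurable P"
    unfolding z\<epsilon>_def by (rule measurable_compose[OF sample_measurable assms(13)])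
  have x\<epsilon>_eq: "x\<epsilon> \<omega> = tilted_mean (emp \<omega>) (transpose A *v z\<epsilon> \<omega>)" if "\<omega> \<in> space P" for \<omega>
  proof -
    \<comment> \<open>A radius that depends on \<open>\<omega>\<close> makes the identity hold everywhere, not just almost surely.\<close>
    have "bounded_vector_measure (emp \<omega>) (\<Sum>i<n. norm (sample \<omega> i))"
      unfolding emp_def using sample_image[OF that] n_pos
      by (intro bounded_vector_measure_empirical) (auto intro: member_le_sum)
    then show ?thesis unfolding x\<epsilon>_def by (rule bounded_vector_measure.grad_log_mgf)
  qed
  have x\<epsilon>_meas [measurable]: "x\<epsilon> \<in> borel_measurable P"
  proof -
    have "(\<lambda>\<omega>. transpose A *v z\<epsilon> \<omega>) \<in> borel_measurable P"
      by (rule borel_measurable_continuous_on[OF _ z\<epsilon>_meas]) (simp add: linear_continuous_on)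
    from tilted_mean_emp_measurable[OF this] show ?thesis
      by (simp add: x\<epsilon>_eq cong: measurable_cong)
  qed

  have z\<epsilon>_close: "AE \<omega> in P. norm (z\<epsilon> \<omega> - z\<mu>) \<le> a * \<delta> \<omega> + e"
    using AE_bounded_vector_measure_emp AE_space
    by eventually_elim
      (use approx_dual_solution_deviation[OF _ bounded_\<mu> z\<mu> z\<epsilon>_approx]
        in \<open>auto simp: a_def e_def \<delta>_def y_def\<close>)
  note dual = P.expectation_le_of_AE_affine[OF _ norm_ge_zero \<delta>_int z\<epsilon>_close]
  have dual_int: "integrable P (\<lambda>\<omega>. norm (z\<epsilon> \<omega> - z\<mu>))" by (rule dual(1)) measurable
  have "P.expectation (\<lambda>\<omega>. norm (z\<epsilon> \<omega> - z\<mu>)) \<le> a * P.expectation \<delta> + e"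
    by (rule dual(2)) measurable
  also have "\<dots> \<le> a * (C' / sqrt n) + e"
    using \<delta>_le nonneg by (intro add_right_mono mult_left_mono)
  finally have dual_le: "P.expectation (\<lambda>\<omega>. norm (z\<epsilon> \<omega> - z\<mu>)) \<le> C / sqrt n + e"
    by (simp add: C_def a_def)

  have primal: "integrable P (\<lambda>\<omega>. norm (x\<epsilon> \<omega> - x\<mu>)) \<and>
      P.expectation (\<lambda>\<omega>. norm (x\<epsilon> \<omega> - x\<mu>)) \<le> (K' * C + C') / sqrt n + K' * e \<and>
      (\<forall>\<gamma>>0. inj (\<lambda>v. A *v v) \<and> strongly_convex (1 / \<gamma>) g \<longrightarrow>
         P.expectation (\<lambda>\<omega>. norm (x\<epsilon> \<omega> - x\<mu>)) \<le> \<gamma> * C / (\<alpha> * sigma_min A) * (1 / sqrt n) + K' * e)"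
    if "primal_solution \<X> g A b \<alpha> \<mu> x\<mu>" for x\<mu>
  proof (intro conjI allI impI)
    have x\<mu>: "x\<mu> = tilted_mean \<mu> (transpose A *v z\<mu>)"
      by (rule \<mu>.primal_solution_eq_tilted_mean[OF assms(7) z\<mu> that])
    have "AE \<omega> in P. norm (x\<epsilon> \<omega> - x\<mu>) \<le> K' * (a * \<delta> \<omega> + e) + \<delta> \<omega>"
      using AE_bounded_vector_measure_emp AE_space z\<epsilon>_close
    proof eventually_elim
      case (elim \<omega>)
      have "norm (x\<epsilon> \<omega> - x\<mu>) \<le> K' * norm (z\<epsilon> \<omega> - z\<mu>) + \<delta> \<omega>"
        using tilted_mean_deviation[OF elim(1), of "z\<epsilon> \<omega>" \<mu> z\<mu>]
        by (simp add: x\<mu> x\<epsilon>_eq[OF elim(2)] K'_def \<delta>_def y_def)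
      with elim(3) nonneg(3) show ?case
        by (meson add_right_mono mult_left_mono order_trans)
    qed
    then have "AE \<omega> in P. norm (x\<epsilon> \<omega> - x\<mu>) \<le> (K' * a + 1) * \<delta> \<omega> + K' * e"
      by (simp add: algebra_simps)
    note bound = P.expectation_le_of_AE_affine[OF _ norm_ge_zero \<delta>_int this]
    show "integrable P (\<lambda>\<omega>. norm (x\<epsilon> \<omega> - x\<mu>))" by (rule bound(1)) measurable
    have "P.expectation (\<lambda>\<omega>. norm (x\<epsilon> \<omega> - x\<mu>)) \<le> (K' * a + 1) * P.expectation \<delta> + K' * e"
      by (rule bound(2)) measurable
    also have "\<dots> \<le> (K' * a + 1) * (C' / sqrt n) + K' * e"
      using \<delta>_le nonneg by (intro add_right_mono mult_left_mono) auto
    also have "(K' * a + 1) * (C' / sqrt n) = (K' * C + C') / sqrt n"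
      by (simp add: C_def a_def add_divide_distrib distrib_right)
    finally show "P.expectation (\<lambda>\<omega>. norm (x\<epsilon> \<omega> - x\<mu>)) \<le> (K' * C + C') / sqrt n + K' * e" .
  next
    fix \<gamma> :: real
    assume "0 < \<gamma>" and "inj (\<lambda>v. A *v v) \<and> strongly_convex (1 / \<gamma>) g"
    then have \<gamma>: "0 < \<gamma>" "inj (\<lambda>v. A *v v)" "strongly_convex (1 / \<gamma>) g" by auto
    have x\<mu>: "x\<mu> = tilted_mean \<mu> (transpose A *v z\<mu>)"
      by (rule \<mu>.primal_solution_eq_tilted_mean[OF assms(7) z\<mu> that])
    define c where "c = \<gamma> / (\<alpha> * sigma_min A)"
    have "0 \<le> c" using \<gamma>(1) \<alpha>_pos sigma_min_bound(1)[OF \<gamma>(2)] by (simp add: c_def)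
    have "AE \<omega> in P. norm (x\<epsilon> \<omega> - x\<mu>) \<le> (c * a) * \<delta> \<omega> + K' * e"
      using AE_bounded_vector_measure_emp AE_space
    proof eventually_elim
      case (elim \<omega>)
      then show ?case
        using tilted_mean_deviation_strongly_convex[OF elim(1) bounded_\<mu> z\<mu> z\<epsilon>_approx[OF elim(2)] \<gamma>]
        by (simp add: x\<mu> x\<epsilon>_eq K'_def \<delta>_def y_def c_def a_def e_def)
    qed
    note bound = P.expectation_le_of_AE_affine[OF _ norm_ge_zero \<delta>_int this]
    have "P.expectation (\<lambda>\<omega>. norm (x\<epsilon> \<omega> - x\<mu>)) \<le> (c * a) * P.expectation \<delta> + K' * e"
      by (rule bound(2)) measurable
    also have "\<dots> \<le> (c * a) * (C' / sqrt n) + K' * e"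
      using \<delta>_le nonneg \<open>0 \<le> c\<close> by (intro add_right_mono mult_left_mono) auto
    also have "(c * a) * (C' / sqrt n) = \<gamma> * C / (\<alpha> * sigma_min A) * (1 / sqrt n)"
      by (simp add: C_def a_def c_def mult_ac)
    finally show "P.expectation (\<lambda>\<omega>. norm (x\<epsilon> \<omega> - x\<mu>))
        \<le> \<gamma> * C / (\<alpha> * sigma_min A) * (1 / sqrt n) + K' * e" .
  qed
  show ?thesis
    unfolding Let_def
    using dual_int dual_le primal
    unfolding C_def C'_def K'_def r_def e_def x\<epsilon>_def z\<epsilon>_def emp_def sample_def
    by blast
qed

end
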